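(* Let $W$ be a quasi-balanced weighing matrix such that $|W|$ is the incidence matrix of a symmetric group divisible design with parameters $(v,k,m,n,\lambda_1,\lambda_2)$ (so $v=mn$, $m,n\ge2$, $k>0$) and such that $|W|\,\mathcal J_{m,n}=\mathcal J_{m,n}\,|W|=\frac{k}{m}J_v$. Write $W=W_1-W_2$ with $W_1,W_2$ disjoint $(0,1)$-matrices, and let $\Pi=\begin{pmatrix}0&1\\1&0\end{pmatrix}$. Define the $4v\times 4v$ matrices $$A_0=\begin{pmatrix} I_2\otimes I_v&0\\0&I_2\otimes I_v\end{pmatrix},\quad A_1=\begin{pmatrix} \Pi\otimes I_v&0\\0&\Pi\otimes I_v\end{pmatrix},$$ $$A_2=\begin{pmatrix} J_2\otimes(\mathcal J_{m,n}-I_v)&0\\0&J_2\otimes(\mathcal J_{m,n}-I_v)\end{pmatrix},\quad A_3=\begin{pmatrix} J_2\otimes (J_v-\mathcal J_{m,n})&0\\0&J_2\otimes (J_v-\mathcal J_{m,n})\end{pmatrix},$$ $$A_4=\begin{pmatrix}0&I_2\otimes W_1+\Pi\otimes W_2\\ I_2\otimes W_1^\top+\Pi\otimes W_2^\top&0\end{pmatrix},\quad A_5=\begin{pmatrix}0&I_2\otimes W_2+\Pi\otimes W_1\\ I_2\otimes W_2^\top+\Pi\otimes W_1^\top&0\end{pmatrix},$$ $$A_6=\begin{pmatrix}0&J_2\otimes(J_v-W_1-W_2)\\ J_2\otimes(J_v-W_1^\top-W_2^\top)&0\end{pmatrix}.$$ If $k<v$, then $\{A_i\}_{i=0}^6$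 is a (symmetric, 6-class) association scheme whose first and second eigenmatrices $P$ and $Q$ (for a suitable ordering of the primitive idempotents) are $$P=\begin{pmatrix} 1 & 1 & 2 (n-1) & 2 (m-1) n & k & k & 2 (m n- k) \\ 1 & -1 & 0 & 0 & \sqrt{k} & -\sqrt{k} & 0 \\ 1 & 1 & 2 (n-1) & -2 n & 0 & 0 & 0 \\ 1 & -1 & 0 & 0 & -\sqrt{k} & \sqrt{k} & 0 \\ 1 & 1 & 2 (n-1) & 2 (m-1) n & -k & -k & 2 (k-m n) \\ 1 & 1 & -2 & 0 & \frac{\sqrt{k (m n-k)}}{\sqrt{m(n-1)}} & \frac{\sqrt{k (m n-k)}}{\sqrt{m(n-1)}} & -\frac{2 \sqrt{k (m n-k)}}{\sqrt{m(n-1)}} \\ 1 & 1 & -2 & 0 & -\frac{\sqrt{k (m n-k)}}{\sqrt{m(n-1)}} & -\frac{\sqrt{k (m n-k)}}{\sqrt{m(n-1)}} & \frac{2 \sqrt{k (m n-k)}}{\sqrt{m(n-1)}} \end{pmatrix},$$ $$Q=\begin{pmatrix} 1 & m n & 2 (m-1) & m n & 1 & m (n-1) & m (n-1) \\ 1 & -m n & 2 (m-1) & -m n & 1 & m (n-1) & m (n-1) \\ 1 & 0 & 2 (m-1) & 0 & 1 & -m & -m \\ 1 & 0 & -2 & 0 & 1 & 0 & 0 \\ 1 & \frac{m n}{\sqrt{k}} & 0 & -\frac{m n}{\sqrt{k}} & -1 & \frac{\sqrt{m(n-1)(m n-k)}}{\sqrt{k}} & -\frac{\sqrt{m(n-1)(m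 n-k)}}{\sqrt{k}} \\ 1 & -\frac{m n}{\sqrt{k}} & 0 & \frac{m n}{\sqrt{k}} & -1 & \frac{\sqrt{m(n-1)(m n-k)}}{\sqrt{k}} & -\frac{\sqrt{m(n-1)(m n-k)}}{\sqrt{k}} \\ 1 & 0 & 0 & 0 & -1 & -\frac{\sqrt{km(n-1)}}{\sqrt{m n-k}} & \frac{\sqrt{km(n-1)}}{\sqrt{m n-k}} \end{pmatrix}.$$
   Context: $I_r$, $J_r$ are the identity and all-ones matrices of order $r$, and $\mathcal J_{m,n}=I_m\otimes J_n$. A weighing matrix of order $v$ and weight $k$ is a $v\times v$ matrix $W$ with entries in $\{0,1,-1\}$ satisfying $WW^\top=kI_v$. $|W|$ is its entrywise absolute value. $W$ is quasi-balanced if $|W|\,|W|^\top=|W|^\top|W|$ and the off-diagonal entries of $|W|\,|W|^\top$ take at most two distinct values. Two $(0,1)$-matrices are disjoint if no position is nonzero in both. For $m,n\ge2$ and $v=mn$, a $v\times v$ $(0,1)$-matrix $A$ is (the incidence matrix of) a symmetric group divisible design with parameters $(v,k,m,n,\lambda_1,\lambda_2)$ if $$AA^\top=A^\top A=kI_v+\lambda_1(\mathcal J_{m,n}-I_v)+\lambda_2(J_v-\mathcal J_{m,n}).$$ A symmetric association scheme with $d$ classes on a finite set $X$ is a set of nonzero $(0,1)$-matrices $A_0,\dots,A_d$ indexed by $X$ with $A_0=I$, $\sum_i A_i=J$, $A_i^\top=A_i$, and $A_iA_j=\sum_{h} p_{ij}^hA_h$ for non-negative integers $p_{ij}^h$.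 Its Bose–Mesner algebra (the complex span of the $A_i$) has a basis of primitive idempotents $E_0=\frac1{|X|}J,E_1,\dots,E_d$, and the first and second eigenmatrices $P,Q$ (rows and columns indexed from $0$ to $d$) are defined by $A_j=\sum_i P_{ij}E_i$ and $E_j=\frac1{|X|}\sum_i Q_{ij}A_i$. *)

theory Defs
  imports Complex_Main "Jordan_Normal_Form.Matrix"
begin

text \<open>All matrices are complex, so that the (0,1)-matrices live in the same type as the
  complex algebra they span; rows and columns are indexed from 0.\<close>

definition all_ones :: "nat \<Rightarrow> complex mat" where
  "all_ones r = mat r r (\<lambda>_. 1)"

definition kron :: "complex mat \<Rightarrow> complex mat \<Rightarrow> complex mat" (infixl "\<Otimes>" 75) where
  "A \<Otimes> B = mat (dim_row A * dim_row B) (dim_col A * dim_col B)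
     (\<lambda>(i, j). A $$ (i div dim_row B, j div dim_col B) * B $$ (i mod dim_row B, j mod dim_col B))"

definition group_ones :: "nat \<Rightarrow> nat \<Rightarrow> complex mat" where
  "group_ones m n = 1\<^sub>m m \<Otimes> all_ones n"

definition swap_mat :: "complex mat" where
  "swap_mat = mat_of_rows_list 2 [[0, 1], [1, 0]]"

definition abs_mat :: "complex mat \<Rightarrow> complex mat" where
  "abs_mat W = map_mat (\<lambda>x. complex_of_real (cmod x)) W"

definition zero_one_mat :: "complex mat \<Rightarrow> bool" where
  "zero_one_mat A \<longleftrightarrow> elements_mat A \<subseteq> {0, 1}"

definition disjoint_mats :: "complex mat \<Rightarrow> complex mat \<Rightarrow> bool" where
  "disjoint_mats A B \<longleftrightarrow> dim_row A = dim_row B \<and> dim_col A = dim_col B \<and>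
     (\<forall>i < dim_row A. \<forall>j < dim_col A. \<not> (A $$ (i, j) \<noteq> 0 \<and> B $$ (i, j) \<noteq> 0))"

definition weighing_matrix :: "nat \<Rightarrow> nat \<Rightarrow> complex mat \<Rightarrow> bool" where
  "weighing_matrix v k W \<longleftrightarrow> W \<in> carrier_mat v v \<and> elements_mat W \<subseteq> {0, 1, -1} \<and>
     W * transpose_mat W = of_nat k \<cdot>\<^sub>m 1\<^sub>m v"

definition quasi_balanced :: "complex mat \<Rightarrow> bool" where
  "quasi_balanced W \<longleftrightarrow>
     abs_mat W * transpose_mat (abs_mat W) = transpose_mat (abs_mat W) * abs_mat W \<and>
     card {(abs_mat W * transpose_mat (abs_mat W)) $$ (i, j) | i j.
             i < dim_row W \<and> j < dim_row W \<and> i \<noteq> j} \<le> 2"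

definition symmetric_gdd ::
  "nat \<Rightarrow> nat \<Rightarrow> nat \<Rightarrow> nat \<Rightarrow> nat \<Rightarrow> nat \<Rightarrow> complex mat \<Rightarrow> bool" where
  "symmetric_gdd v k m n l1 l2 A \<longleftrightarrow>
     2 \<le> m \<and> 2 \<le> n \<and> v = m * n \<and> A \<in> carrier_mat v v \<and> zero_one_mat A \<and>
     A * transpose_mat A = transpose_mat A * A \<and>
     A * transpose_mat A =
       of_nat k \<cdot>\<^sub>m 1\<^sub>m v + of_nat l1 \<cdot>\<^sub>m (group_ones m n - 1\<^sub>m v)
         + of_nat l2 \<cdot>\<^sub>m (all_ones v - group_ones m n)"

text \<open>The linear combination of $A_0, \dots, A_d$, all of order $N$, with coefficients $c_i$.
  It is written entrywise because matrices without fixed dimensions have no additive unit.\<close>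

definition lin_comb :: "nat \<Rightarrow> nat \<Rightarrow> (nat \<Rightarrow> complex) \<Rightarrow> (nat \<Rightarrow> complex mat) \<Rightarrow> complex mat" where
  "lin_comb N d c A = mat N N (\<lambda>ij. \<Sum>i\<le>d. c i * A i $$ ij)"

text \<open>The underlying set has $N$ points; only the values of $A$ at $0, \dots, d$ matter.\<close>

definition symmetric_association_scheme :: "nat \<Rightarrow> nat \<Rightarrow> (nat \<Rightarrow> complex mat) \<Rightarrow> bool" where
  "symmetric_association_scheme N d A \<longleftrightarrow>
     (\<forall>i\<le>d. A i \<in> carrier_mat N N \<and> A i \<noteq> 0\<^sub>m N N \<and> zero_one_mat (A i)) \<and>
     A 0 = 1\<^sub>m N \<and>
     lin_comb N d (\<lambda>_. 1) A = all_ones N \<and>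
     (\<forall>i\<le>d. transpose_mat (A i) = A i) \<and>
     (\<exists>p :: nat \<Rightarrow> nat \<Rightarrow> nat \<Rightarrow> nat. \<forall>i\<le>d. \<forall>j\<le>d.
        A i * A j = lin_comb N d (\<lambda>h. of_nat (p i j h)) A)"

definition bose_mesner :: "nat \<Rightarrow> nat \<Rightarrow> (nat \<Rightarrow> complex mat) \<Rightarrow> complex mat set" where
  "bose_mesner N d A = {lin_comb N d c A | c. True}"

definition nonzero_idempotents :: "nat \<Rightarrow> complex mat set \<Rightarrow> complex mat set" where
  "nonzero_idempotents N B = {E \<in> B. E \<noteq> 0\<^sub>m N N \<and> E * E = E}"

definition primitive_idempotents :: "nat \<Rightarrow> complex mat set \<Rightarrow> complex mat set" where
  "primitive_idempotents N B = {E \<in> nonzero_idempotents N B.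
     \<not> (\<exists>F \<in> nonzero_idempotents N B. \<exists>G \<in> nonzero_idempotents N B.
          F * G = 0\<^sub>m N N \<and> G * F = 0\<^sub>m N N \<and> E = F + G)}"

text \<open>An enumeration $E_0, \dots, E_d$, without repetition, of all the primitive idempotents of
  the Bose--Mesner algebra, starting with the trivial one.\<close>

definition idempotent_ordering ::
  "nat \<Rightarrow> nat \<Rightarrow> (nat \<Rightarrow> complex mat) \<Rightarrow> (nat \<Rightarrow> complex mat) \<Rightarrow> bool" where
  "idempotent_ordering N d A E \<longleftrightarrow>
     bij_betw E {..d} (primitive_idempotents N (bose_mesner N d A)) \<and>
     E 0 = (1 / of_nat N) \<cdot>\<^sub>m all_ones N"

definition first_eigenmatrix ::
  "nat \<Rightarrow> nat \<Rightarrow> (nat \<Rightarrow> complex mat) \<Rightarrow> (nat \<Rightarrow> complex mat) \<Rightarrow> complex mat \<Rightarrow> bool" where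
  "first_eigenmatrix N d A E P \<longleftrightarrow> P \<in> carrier_mat (d + 1) (d + 1) \<and>
     (\<forall>j\<le>d. A j = lin_comb N d (\<lambda>i. P $$ (i, j)) E)"

definition second_eigenmatrix ::
  "nat \<Rightarrow> nat \<Rightarrow> (nat \<Rightarrow> complex mat) \<Rightarrow> (nat \<Rightarrow> complex mat) \<Rightarrow> complex mat \<Rightarrow> bool" where
  "second_eigenmatrix N d A E Q \<longleftrightarrow> Q \<in> carrier_mat (d + 1) (d + 1) \<and>
     (\<forall>j\<le>d. E j = (1 / of_nat N) \<cdot>\<^sub>m lin_comb N d (\<lambda>i. Q $$ (i, j)) A)"

definition block_diag :: "complex mat \<Rightarrow> complex mat" where
  "block_diag X = four_block_mat
     X (0\<^sub>m (dim_row X) (dim_col X))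
     (0\<^sub>m (dim_row X) (dim_col X)) X"

definition block_antidiag :: "complex mat \<Rightarrow> complex mat \<Rightarrow> complex mat" where
  "block_antidiag X Y = four_block_mat
     (0\<^sub>m (dim_row X) (dim_col Y)) X
     Y (0\<^sub>m (dim_row Y) (dim_col X))"

definition gdd_scheme :: "nat \<Rightarrow> nat \<Rightarrow> complex mat \<Rightarrow> complex mat \<Rightarrow> nat \<Rightarrow> complex mat" where
  "gdd_scheme m n W1 W2 i =
    (let v = m * n in
     [block_diag (1\<^sub>m 2 \<Otimes> 1\<^sub>m v),
      block_diag (swap_mat \<Otimes> 1\<^sub>m v),
      block_diag (all_ones 2 \<Otimes> (group_ones m n - 1\<^sub>m v)),
      block_diag (all_ones 2 \<Otimes> (all_ones v - group_ones m n)),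
      block_antidiag
        (1\<^sub>m 2 \<Otimes> W1 + swap_mat \<Otimes> W2)
        (1\<^sub>m 2 \<Otimes> transpose_mat W1 + swap_mat \<Otimes> transpose_mat W2),
      block_antidiag
        (1\<^sub>m 2 \<Otimes> W2 + swap_mat \<Otimes> W1)
        (1\<^sub>m 2 \<Otimes> transpose_mat W2 + swap_mat \<Otimes> transpose_mat W1),
      block_antidiag
        (all_ones 2 \<Otimes> (all_ones v - W1 - W2))
        (all_ones 2 \<Otimes> (all_ones v - transpose_mat W1 - transpose_mat W2))] ! i)"

definition gdd_P :: "real \<Rightarrow> real \<Rightarrow> real \<Rightarrow> complex mat" where
  "gdd_P m n k = map_mat complex_of_real
    (let r = sqrt (k * (m * n - k)) / sqrt (m * (n - 1)) in
     mat_of_rows_list 7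
      [[1,  1, 2 * (n - 1), 2 * (m - 1) * n,      k,        k,        2 * (m * n - k)],
       [1, -1, 0,           0,                    sqrt k,   - sqrt k, 0],
       [1,  1, 2 * (n - 1), - 2 * n,              0,        0,        0],
       [1, -1, 0,           0,                    - sqrt k, sqrt k,   0],
       [1,  1, 2 * (n - 1), 2 * (m - 1) * n,      - k,      - k,      2 * (k - m * n)],
       [1,  1, - 2,         0,                    r,        r,        - 2 * r],
       [1,  1, - 2,         0,                    - r,      - r,      2 * r]])"

definition gdd_Q :: "real \<Rightarrow> real \<Rightarrow> real \<Rightarrow> complex mat" where
  "gdd_Q m n k = map_mat complex_of_real
    (let s = m * n / sqrt k;
         t = sqrt (m * (n - 1) * (m * n - k)) / sqrt k;
         u = sqrt (k * m * (n - 1)) / sqrt (m * n - k) in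
     mat_of_rows_list 7
      [[1, m * n,     2 * (m - 1), m * n,     1,   m * (n - 1), m * (n - 1)],
       [1, - (m * n), 2 * (m - 1), - (m * n), 1,   m * (n - 1), m * (n - 1)],
       [1, 0,         2 * (m - 1), 0,         1,   - m,         - m],
       [1, 0,         - 2,         0,         1,   0,           0],
       [1, s,         0,           - s,       - 1, t,           - t],
       [1, - s,       0,           s,         - 1, t,           - t],
       [1, 0,         0,           0,         - 1, - u,         u]])"

end

theory Submission
  imports Defs "Jordan_Normal_Form.Determinant"
begin

text \<open>
  Put \<open>E\<^sub>j = (1/4v) \<Sum>\<^sub>i Q\<^sub>i\<^sub>j A\<^sub>i\<close>. Since \<open>QP = 4v I\<close>, it is enough to show that the \<open>E\<^sub>j\<close> are nonzero orthogonal
  idempotents: then the \<open>A\<^sub>i\<close> and the \<open>E\<^sub>j\<close> span the same algebra and the primitive idempotents are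
  exactly the \<open>E\<^sub>j\<close>. The algebra splits along the two characters of the group generated by \<open>\<Pi>\<close>.
  On the alternating part only \<open>I\<close> and \<open>W\<close> survive, and \<open>W W\<^sup>T = W\<^sup>T W = kI\<close> gives \<open>E\<^sub>1\<close> and \<open>E\<^sub>3\<close>. On the
  trivial part only \<open>I\<close>, \<open>G = I\<^sub>m \<otimes> J\<^sub>n\<close>, \<open>J\<close> and \<open>|W|\<close> survive; there the hypotheses force
  \<open>|W| |W|\<^sup>T = r\<^sup>2 (I - G/n) + (k\<^sup>2/v) J\<close> with \<open>r\<^sup>2 = k(v - k)/(m(n - 1))\<close>, which gives the other five.
\<close>

section \<open>Association schemes from orthogonal idempotents\<close>

text \<open>Write A for |W|. The relation forced on A comes from computing A A^T G twice: the design
  formula expresses it through G and J, the group hypothesis through J alone, and comparing a pair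
  of points inside one group with a pair in two groups fixes both design parameters. Because A G = G
  A = (k/m) J, the off-diagonal blocks of a product never involve G. Hence five coefficients (I, G,
  J on the diagonal blocks; A, J off them) describe an element of the trivial part, and two (I and
  W) an element of the alternating part. Products are computed once for general coefficients, so
  that orthogonality of the idempotents becomes a list of identities between numbers. The number r
  is the singular value of A on vectors that sum to zero over every group, just as sqrt k is the
  singular value of W on all vectors; their two signs give the pairs E_5, E_6 and E_1, E_3. Vectors
  constant on groups supply the rest: the global constants give E_0 and E_4, and on those of total
  sum zero A vanishes, which leaves the single E_2. The bound k < v enters twice: it makes r
  nonzero, and it makes A_6 nonzero.\<close>

lemma lin_comb_carrier [simp]: "lin_comb N d c A \<in> carrier_mat N N"
  by (simp add: lin_comb_def)

lemma lin_comb_index [simp]: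
  "a < N \<Longrightarrow> b < N \<Longrightarrow> lin_comb N d c A $$ (a, b) = (\<Sum>i\<le>d. c i * A i $$ (a, b))"
  by (simp add: lin_comb_def)

lemma index_mult_mat_sum:
  assumes "A \<in> carrier_mat N M" "B \<in> carrier_mat M L" "a < N" "b < L"
  shows "(A * B) $$ (a, b) = (\<Sum>c<M. A $$ (a, c) * B $$ (c, b))"
  using assms by (simp add: scalar_prod_def atLeast0LessThan)

lemma lin_comb_cong: "(\<And>i. i \<le> d \<Longrightarrow> c i = c' i) \<Longrightarrow> lin_comb N d c A = lin_comb N d c' A"
  unfolding lin_comb_def by (intro cong_mat refl sum.cong) auto

text \<open>Change of basis. It is applied in both directions, with coefficients from Q and from P,
  to show that the \<open>A i\<close> and the \<open>E i\<close> span the same algebra, and again to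
  rewrite products in terms of the \<open>A i\<close>.\<close>

lemma lin_comb_trans:
  assumes "\<And>j. j \<le> d \<Longrightarrow> B j = lin_comb N d (M j) A"
  shows "lin_comb N d c B = lin_comb N d (\<lambda>i. \<Sum>j\<le>d. c j * M j i) A"
proof (rule eq_matI)
  fix a b assume "a < dim_row (lin_comb N d (\<lambda>i. \<Sum>j\<le>d. c j * M j i) A)"
    "b < dim_col (lin_comb N d (\<lambda>i. \<Sum>j\<le>d. c j * M j i) A)"
  then have ab: "a < N" "b < N" by (auto simp: lin_comb_def)
  have "lin_comb N d c B $$ (a, b) = (\<Sum>j\<le>d. \<Sum>i\<le>d. c j * M j i * A i $$ (a, b))"
    using ab assms by (auto simp: sum_distrib_left mult.assoc intro!: sum.cong)
  also have "\<dots> = (\<Sum>i\<le>d. \<Sum>j\<le>d. c j * M j i * A i $$ (a, b))"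
    by (rule sum.swap)
  finally show "lin_comb N d c B $$ (a, b) = lin_comb N d (\<lambda>i. \<Sum>j\<le>d. c j * M j i) A $$ (a, b)"
    using ab by (simp add: sum_distrib_right)
qed (auto simp: lin_comb_def)

lemma lin_comb_single:
  assumes "i \<le> d" "A i \<in> carrier_mat N N"
  shows "lin_comb N d (\<lambda>h. if h = i then c else 0) A = c \<cdot>\<^sub>m A i"
proof (rule eq_matI)
  fix a b assume "a < dim_row (c \<cdot>\<^sub>m A i)" "b < dim_col (c \<cdot>\<^sub>m A i)"
  with assms have "a < N" "b < N" by auto
  with assms show "lin_comb N d (\<lambda>h. if h = i then c else 0) A $$ (a, b) = (c \<cdot>\<^sub>m A i) $$ (a, b)"
    by (simp add: if_distrib[where f = "\<lambda>x. x * _"] cong: if_cong)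
qed (use assms in \<open>auto simp: lin_comb_def\<close>)

lemma lin_comb_add:
  "lin_comb N d c A + lin_comb N d c' A = lin_comb N d (\<lambda>i. c i + c' i) A"
  by (rule eq_matI) (auto simp: lin_comb_def algebra_simps sum.distrib)

lemma lin_comb_smult:
  "x \<cdot>\<^sub>m lin_comb N d c A = lin_comb N d (\<lambda>i. x * c i) A"
  by (rule eq_matI) (auto simp: lin_comb_def algebra_simps sum_distrib_left)

lemma lin_comb_zero: "(\<And>i. i \<le> d \<Longrightarrow> c i = 0) \<Longrightarrow> lin_comb N d c A = 0\<^sub>m N N"
  by (rule eq_matI) (auto simp: lin_comb_def)

locale orthogonal_idempotents =
  fixes N d :: nat and E :: "nat \<Rightarrow> complex mat"
  assumes carrier: "i \<le> d \<Longrightarrow> E i \<in> carrier_mat N N"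
    and orth: "i \<le> d \<Longrightarrow> j \<le> d \<Longrightarrow> E i * E j = (if i = j then E i else 0\<^sub>m N N)"
    and nonzero: "i \<le> d \<Longrightarrow> E i \<noteq> 0\<^sub>m N N"
begin

text \<open>Orthogonality kills the cross terms, so multiplication is coordinatewise. Everything
  about idempotents below is then a question about tuples of complex numbers.\<close>

lemma lin_comb_mult:
  "lin_comb N d x E * lin_comb N d y E = lin_comb N d (\<lambda>i. x i * y i) E"
proof (rule eq_matI)
  fix a b assume "a < dim_row (lin_comb N d (\<lambda>i. x i * y i) E)"
    "b < dim_col (lin_comb N d (\<lambda>i. x i * y i) E)"
  then have ab: "a < N" "b < N" by (auto simp: lin_comb_def)
  have "(lin_comb N d x E * lin_comb N d y E) $$ (a, b) =
      (\<Sum>c<N. (\<Sum>i\<le>d. x i * E i $$ (a, c)) * (\<Sum>j\<le>d. y j * E j $$ (c, b)))"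
    using ab by (subst index_mult_mat_sum[of _ N N]) auto
  also have "\<dots> = (\<Sum>c<N. \<Sum>i\<le>d. \<Sum>j\<le>d. x i * y j * (E i $$ (a, c) * E j $$ (c, b)))"
    by (simp add: sum_product algebra_simps)
  also have "\<dots> = (\<Sum>i\<le>d. \<Sum>j\<le>d. \<Sum>c<N. x i * y j * (E i $$ (a, c) * E j $$ (c, b)))"
    by (subst sum.swap, rule sum.cong[OF refl], rule sum.swap)
  also have "\<dots> = (\<Sum>i\<le>d. \<Sum>j\<le>d. x i * y j * (E i * E j) $$ (a, b))"
    using ab index_mult_mat_sum[OF carrier carrier] by (simp add: sum_distrib_left)
  also have "\<dots> = (\<Sum>i\<le>d. \<Sum>j\<le>d. if i = j then x i * y i * E i $$ (a, b) else 0)"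
    using ab by (intro sum.cong refl) (auto simp: orth)
  also have "\<dots> = (\<Sum>i\<le>d. x i * y i * E i $$ (a, b))"
    by simp
  finally show "(lin_comb N d x E * lin_comb N d y E) $$ (a, b) =
      lin_comb N d (\<lambda>i. x i * y i) E $$ (a, b)"
    using ab by simp
qed (auto simp: lin_comb_def)

lemma lin_comb_indicator: "i \<le> d \<Longrightarrow> lin_comb N d (\<lambda>h. if h = i then 1 else 0) E = E i"
  using lin_comb_single[of i d E N 1] carrier[of i] by (auto intro!: eq_matI)

text \<open>Linear independence: multiplying by \<open>E i\<close> leaves only the
  \<open>i\<close>-th coefficient times \<open>E i\<close>, and a nonzero entry of
  \<open>E i\<close> can be cancelled.\<close>

lemma lin_comb_eqD:
  assumes eq: "lin_comb N d x E = lin_comb N d y E" and i: "i \<le> d"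
  shows "x i = y i"
proof -
  obtain a b where ab: "a < N" "b < N" "E i $$ (a, b) \<noteq> 0"
    using nonzero[OF i] carrier[OF i] eq_matI[of "0\<^sub>m N N" "E i"] by (metis carrier_matD index_zero_mat)
  have *: "lin_comb N d z E * E i = z i \<cdot>\<^sub>m E i" for z
  proof -
    have "lin_comb N d z E * E i = lin_comb N d (\<lambda>h. z h * (if h = i then 1 else 0)) E"
      using lin_comb_mult[of z "\<lambda>h. if h = i then 1 else 0"] i by (simp add: lin_comb_indicator)
    also have "\<dots> = lin_comb N d (\<lambda>h. if h = i then z i else 0) E"
      by (rule lin_comb_cong) auto
    finally show ?thesis using lin_comb_single[of i d E N "z i"] carrier[OF i] i by simp
  qed
  have "x i \<cdot>\<^sub>m E i = y i \<cdot>\<^sub>m E i" using *[of x] *[of y] eq by simp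
  then have "(x i \<cdot>\<^sub>m E i) $$ (a, b) = (y i \<cdot>\<^sub>m E i) $$ (a, b)" by simp
  then show ?thesis using ab carrier[OF i] by simp
qed

text \<open>Coordinatewise x^2 = x forces 0 or 1, so nonzero idempotents correspond to nonempty
  subsets of \<open>{..d}\<close>; the primitive ones will be the singletons.\<close>

lemma mem_nonzero_idempotents:
  "F \<in> nonzero_idempotents N (bose_mesner N d E) \<longleftrightarrow>
    (\<exists>f. F = lin_comb N d f E \<and> (\<forall>i\<le>d. f i = 0 \<or> f i = 1) \<and> (\<exists>i\<le>d. f i = 1))"
    (is "?L \<longleftrightarrow> ?R")
proof
  assume ?L
  then obtain f where f: "F = lin_comb N d f E" "F \<noteq> 0\<^sub>m N N" "F * F = F"
    by (auto simp: nonzero_idempotents_def bose_mesner_def)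
  have 1: "f i * f i = f i" if "i \<le> d" for i
    using lin_comb_eqD[of "\<lambda>i. f i * f i" f i] that f by (simp add: lin_comb_mult)
  then have "f i = 0 \<or> f i = 1" if "i \<le> d" for i using that by force
  moreover have "\<exists>i\<le>d. f i = 1"
    using f calculation lin_comb_zero[of d f N E] by blast
  ultimately show ?R using f by blast
next
  assume ?R
  then obtain f i where f: "F = lin_comb N d f E" "\<forall>i\<le>d. f i = 0 \<or> f i = 1" "i \<le> d" "f i = 1"
    by blast
  have "F * F = F"
    unfolding f(1) lin_comb_mult using f(2) by (intro lin_comb_cong) auto
  moreover have "F \<noteq> 0\<^sub>m N N"
    using lin_comb_eqD[of f "\<lambda>_. 0" i] f by (auto simp: lin_comb_zero)
  ultimately show ?L using f by (auto simp: nonzero_idempotents_def bose_mesner_def)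
qed

lemma E_mem: "i \<le> d \<Longrightarrow> E i \<in> nonzero_idempotents N (bose_mesner N d E)"
  unfolding mem_nonzero_idempotents
  by (rule exI[of _ "\<lambda>h. if h = i then 1 else 0"]) (auto simp: lin_comb_indicator)

lemma E_primitive:
  assumes "i \<le> d"
  shows "E i \<in> primitive_idempotents N (bose_mesner N d E)"
proof -
  have False if F: "F \<in> nonzero_idempotents N (bose_mesner N d E)"
    and G: "G \<in> nonzero_idempotents N (bose_mesner N d E)"
    and z: "F * G = 0\<^sub>m N N" and s: "E i = F + G" for F G
  proof -
    obtain f j where f: "F = lin_comb N d f E" "\<forall>i\<le>d. f i = 0 \<or> f i = 1" "j \<le> d" "f j = 1"
      using F unfolding mem_nonzero_idempotents by blast
    obtain g l where g: "G = lin_comb N d g E" "\<forall>i\<le>d. g i = 0 \<or> g i = 1" "l \<le> d" "g l = 1"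
      using G unfolding mem_nonzero_idempotents by blast
    \<comment> \<open>F and G have disjoint supports because their product vanishes, and the two
      supports together have to form the singleton of \<open>i\<close>.\<close>
    have "f h * g h = 0" if "h \<le> d" for h
      using z lin_comb_eqD[of "\<lambda>h. f h * g h" "\<lambda>_. 0" h] that
      unfolding f g lin_comb_mult by (simp add: lin_comb_zero)
    moreover have "(if h = i then 1 else 0) = f h + g h" if "h \<le> d" for h
      using s lin_comb_eqD[of "\<lambda>h. if h = i then 1 else 0" "\<lambda>h. f h + g h" h] that assms
      unfolding f g lin_comb_add by (simp add: lin_comb_indicator)
    \<comment> \<open>Each of F and G has a coefficient 1, which can only sit at \<open>i\<close>;
      then \<open>f i * g i\<close> would be 1.\<close>
    ultimately show False using f g assms
      by (metis add.right_neutral add_0 mult_1 mult.right_neutral zero_neq_one)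
  qed
  then show ?thesis using E_mem[OF assms] unfolding primitive_idempotents_def by blast
qed

lemma primitive_is_E:
  assumes "F \<in> primitive_idempotents N (bose_mesner N d E)"
  shows "F \<in> E ` {..d}"
proof (rule ccontr)
  assume n: "F \<notin> E ` {..d}"
  have "F \<in> nonzero_idempotents N (bose_mesner N d E)"
    using assms by (auto simp: primitive_idempotents_def)
  then obtain f i where f: "F = lin_comb N d f E" "\<forall>i\<le>d. f i = 0 \<or> f i = 1" "i \<le> d" "f i = 1"
    unfolding mem_nonzero_idempotents by blast
  have "\<exists>j\<le>d. j \<noteq> i \<and> f j = 1"
  proof (rule ccontr)
    assume "\<not> ?thesis"
    then have "F = lin_comb N d (\<lambda>h. if h = i then 1 else 0) E"
      unfolding f(1) using f by (intro lin_comb_cong) auto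
    then show False using n f lin_comb_indicator by auto
  qed
  then obtain j where j: "j \<le> d" "j \<noteq> i" "f j = 1" by blast
  \<comment> \<open>Splitting off coordinate \<open>i\<close> writes F as \<open>E i + ?G\<close>;
    the second coordinate \<open>j\<close> keeps \<open>?G\<close> nonzero, so F is
    decomposable.\<close>
  let ?g = "\<lambda>h. if h = i then 0 else f h"
  let ?G = "lin_comb N d ?g E"
  have G: "?G \<in> nonzero_idempotents N (bose_mesner N d E)"
    unfolding mem_nonzero_idempotents using f j by (intro exI[of _ ?g]) auto
  have "E i * ?G = 0\<^sub>m N N" "?G * E i = 0\<^sub>m N N"
    unfolding lin_comb_indicator[OF \<open>i \<le> d\<close>, symmetric] lin_comb_mult by (auto intro!: lin_comb_zero)
  moreover have "F = E i + ?G"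
    unfolding lin_comb_indicator[OF \<open>i \<le> d\<close>, symmetric] lin_comb_add f(1)
    using f by (intro lin_comb_cong) auto
  ultimately show False using assms G E_mem[OF \<open>i \<le> d\<close>] unfolding primitive_idempotents_def by blast
qed

lemma bij_primitive: "bij_betw E {..d} (primitive_idempotents N (bose_mesner N d E))"
proof -
  have "inj_on E {..d}"
    by (rule inj_onI) (metis atMost_iff nonzero orth)
  moreover have "E ` {..d} = primitive_idempotents N (bose_mesner N d E)"
    using E_primitive primitive_is_E by blast
  ultimately show ?thesis by (simp add: bij_betw_def)
qed

end

section \<open>Recovering the scheme axioms and both eigenmatrices from the idempotents\<close>

lemma zero_one_mat_index:
  "zero_one_mat A \<longleftrightarrow> (\<forall>i<dim_row A. \<forall>j<dim_col A. A $$ (i, j) \<in> {0, 1})"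
  unfolding zero_one_mat_def elements_mat_def by (fastforce simp: image_subset_iff)

text \<open>The complex sum is turned into a natural-number count, where a second index with value 1
  would make the total at least 2. It expresses that every position is covered by exactly one
  relation matrix.\<close>

lemma sum_zero_one_eq_1:
  fixes f :: "nat \<Rightarrow> complex"
  assumes "\<And>i. i \<le> d \<Longrightarrow> f i \<in> {0, 1}" "(\<Sum>i\<le>d. f i) = 1" "h \<le> d" "f h = 1" "i \<le> d" "i \<noteq> h"
  shows "f i = 0"
proof (rule ccontr)
  assume "f i \<noteq> 0"
  then have fi: "f i = 1" using assms by auto
  have "(\<Sum>i\<le>d. f i) = (\<Sum>i\<le>d. of_nat (if f i = 1 then 1 else 0))"
    using assms(1) by (intro sum.cong) auto
  then have s: "of_nat (\<Sum>i\<le>d. (if f i = 1 then 1 else 0)) = (1 :: complex)"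
    using assms(2) by simp
  have "(\<Sum>i\<in>{h, i}. if f i = 1 then 1 else 0) \<le> (\<Sum>i\<le>d. (if f i = 1 then 1 else 0 :: nat))"
    using assms by (intro sum_mono2) auto
  then have "2 \<le> (\<Sum>i\<le>d. (if f i = 1 then 1 else 0 :: nat))" using assms fi by simp
  then show False using s by (metis of_nat_eq_1_iff Suc_1 not_less_eq_eq order_refl)
qed

text \<open>The intersection numbers are non-negative integers because each one is an entry of a
  product of \<open>(0,1)\<close>-matrices.\<close>

lemma scheme_from_idempotents:
  assumes A: "\<And>i. i \<le> d \<Longrightarrow> A i \<in> carrier_mat N N"
    and A_nz: "\<And>i. i \<le> d \<Longrightarrow> A i \<noteq> 0\<^sub>m N N"
    and A_01: "\<And>i. i \<le> d \<Longrightarrow> zero_one_mat (A i)"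
    and A_sym: "\<And>i. i \<le> d \<Longrightarrow> transpose_mat (A i) = A i"
    and A_0: "A 0 = 1\<^sub>m N"
    and A_sum: "lin_comb N d (\<lambda>_. 1) A = all_ones N"
    and P: "P \<in> carrier_mat (d + 1) (d + 1)"
    and Q: "Q \<in> carrier_mat (d + 1) (d + 1)"
    and Q0: "\<And>i. i \<le> d \<Longrightarrow> Q $$ (i, 0) = 1"
    and N: "N > 0"
    and QP: "\<And>h j. h \<le> d \<Longrightarrow> j \<le> d \<Longrightarrow>
      (\<Sum>i\<le>d. Q $$ (h, i) * P $$ (i, j)) = (if h = j then of_nat N else 0)"
    and EA: "\<And>j. j \<le> d \<Longrightarrow> E j = (1 / of_nat N) \<cdot>\<^sub>m lin_comb N d (\<lambda>i. Q $$ (i, j)) A"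
    and E: "orthogonal_idempotents N d E"
  shows "symmetric_association_scheme N d A \<and> idempotent_ordering N d A E \<and>
    first_eigenmatrix N d A E P \<and> second_eigenmatrix N d A E Q"
proof -
  interpret orthogonal_idempotents N d E by fact
  have EA': "E j = lin_comb N d (\<lambda>i. 1 / of_nat N * Q $$ (i, j)) A" if "j \<le> d" for j
    using EA[OF that] by (simp add: lin_comb_smult)
  \<comment> \<open>Substituting the \<open>E i\<close>, the coefficient of \<open>A h\<close>
    becomes the entry (h, j) of QP divided by \<open>N\<close>, so QP = N I inverts the defining
    relation.\<close>
  have AE: "A j = lin_comb N d (\<lambda>i. P $$ (i, j)) E" if j: "j \<le> d" for j
  proof -
    have "lin_comb N d (\<lambda>i. P $$ (i, j)) E =
        lin_comb N d (\<lambda>h. \<Sum>i\<le>d. P $$ (i, j) * (1 / of_nat N * Q $$ (h, i))) A"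
      using lin_comb_trans[where B = E and A = A, OF EA'] by simp
    also have "\<dots> = lin_comb N d (\<lambda>h. if h = j then 1 else 0) A"
    proof (rule lin_comb_cong)
      fix h assume h: "h \<le> d"
      have "(\<Sum>i\<le>d. P $$ (i, j) * (1 / of_nat N * Q $$ (h, i))) =
          1 / of_nat N * (\<Sum>i\<le>d. Q $$ (h, i) * P $$ (i, j))"
        by (simp add: sum_distrib_left algebra_simps)
      then show "(\<Sum>i\<le>d. P $$ (i, j) * (1 / of_nat N * Q $$ (h, i))) = (if h = j then 1 else 0)"
        using QP[OF h j] N by simp
    qed
    also have "\<dots> = A j" using lin_comb_single[of j d A N 1] A[OF j] j by (auto intro!: eq_matI)
    finally show ?thesis by simp
  qed
  have "bose_mesner N d A = bose_mesner N d E"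
    unfolding bose_mesner_def
    using lin_comb_trans[where B = E and A = A, OF EA'] lin_comb_trans[where B = A and A = E, OF AE] by blast
  \<comment> \<open>The column of Q with index 0 consists of ones, so \<open>E 0\<close> is the sum
    of all \<open>A i\<close> divided by \<open>N\<close>, that is J / N.\<close>
  then have "idempotent_ordering N d A E"
    unfolding idempotent_ordering_def using bij_primitive EA[of 0] lin_comb_cong[of d "\<lambda>i. Q $$ (i, 0)" "\<lambda>_. 1" N A]
    by (simp add: Q0 A_sum)
  moreover have 01: "A i $$ (a, b) \<in> {0, 1}" if "i \<le> d" "a < N" "b < N" for i a b
    using A_01[OF that(1)] A[OF that(1)] that unfolding zero_one_mat_index by blast
  have nat: "\<exists>c::nat. lin_comb N d x A $$ (a, b) = of_nat c"
    if ij: "i \<le> d" "j \<le> d" and x: "A i * A j = lin_comb N d x A" and ab: "a < N" "b < N" for i j x a b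
  proof -
    have "A i $$ (a, c) * A j $$ (c, b) \<in> \<nat>" if "c < N" for c
    proof -
      have "A i $$ (a, c) \<in> {0, 1}" "A j $$ (c, b) \<in> {0, 1}"
        using 01 ij ab that by blast+
      then show ?thesis by (elim insertE emptyE) simp_all
    qed
    then have "(\<Sum>c<N. A i $$ (a, c) * A j $$ (c, b)) \<in> \<nat>" by (induction N) auto
    moreover have "lin_comb N d x A $$ (a, b) = (\<Sum>c<N. A i $$ (a, c) * A j $$ (c, b))"
      unfolding x[symmetric] using ij ab A by (intro index_mult_mat_sum)
    ultimately show ?thesis by (auto elim: Nats_cases)
  qed
  moreover have "\<exists>p :: nat \<Rightarrow> nat. A i * A j = lin_comb N d (\<lambda>h. of_nat (p h)) A" if ij: "i \<le> d" "j \<le> d" for i j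
  proof -
    have "A i * A j = lin_comb N d (\<lambda>h. P $$ (h, i) * P $$ (h, j)) E"
      using AE ij lin_comb_mult by simp
    also have "\<dots> = lin_comb N d (\<lambda>l. \<Sum>h\<le>d. P $$ (h, i) * P $$ (h, j) * (1 / of_nat N * Q $$ (l, h))) A"
      by (rule lin_comb_trans) (rule EA')
    finally obtain x where x: "A i * A j = lin_comb N d x A" by blast
    have "\<exists>c::nat. x h = of_nat c" if h: "h \<le> d" for h
    proof -
      \<comment> \<open>At any position where \<open>A h\<close> is 1 all other relation matrices
        vanish, so the coefficient \<open>x h\<close> equals the entry of \<open>A i * A j\<close>
        there, which is a natural number.\<close>
      obtain a b where ab: "a < N" "b < N" "A h $$ (a, b) \<noteq> 0"
        using A_nz[OF h] A[OF h] eq_matI[of "0\<^sub>m N N" "A h"] by (metis carrier_matD index_zero_mat)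
      have "(\<Sum>l\<le>d. A l $$ (a, b)) = 1"
        using arg_cong[OF A_sum, of "\<lambda>M. M $$ (a, b)"] ab by (simp add: all_ones_def)
      then have "A l $$ (a, b) = 0" if "l \<le> d" "l \<noteq> h" for l
        using sum_zero_one_eq_1[of d "\<lambda>l. A l $$ (a, b)" h l] 01[OF _ ab(1,2)] 01[OF h ab(1,2)] that h ab(3) by auto
      then have "(\<Sum>l\<le>d. x l * A l $$ (a, b)) = (\<Sum>l\<le>d. if l = h then x h else 0)"
        using 01[OF h ab(1,2)] ab(3) by (intro sum.cong) auto
      then have "lin_comb N d x A $$ (a, b) = (\<Sum>l\<le>d. if l = h then x h else 0)"
        using ab by simp
      also have "\<dots> = x h" using h by simp
      finally show ?thesis using nat[OF ij x ab(1,2)] by simp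
    qed
    then obtain p :: "nat \<Rightarrow> nat" where "\<And>h. h \<le> d \<Longrightarrow> x h = of_nat (p h)" by metis
    then show ?thesis using x lin_comb_cong[of d x] by metis
  qed
  then have "\<exists>p :: nat \<Rightarrow> nat \<Rightarrow> nat \<Rightarrow> nat. \<forall>i\<le>d. \<forall>j\<le>d. A i * A j = lin_comb N d (\<lambda>h. of_nat (p i j h)) A"
    by metis
  ultimately show ?thesis
    using assms AE by (simp add: symmetric_association_scheme_def first_eigenmatrix_def second_eigenmatrix_def)
qed

section \<open>Matrices constant on groups\<close>

definition delta :: "nat \<Rightarrow> nat \<Rightarrow> complex" where
  "delta x y = (if x = y then 1 else 0)"

text \<open>The entry function of G: the Kronecker order of the points puts group p at the positions
  from p n to p n + n - 1.\<close>

definition same_group :: "nat \<Rightarrow> nat \<Rightarrow> nat \<Rightarrow> complex" where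
  "same_group n x y = (if x div n = y div n then 1 else 0)"

lemma sum_delta_left: "x < v \<Longrightarrow> (\<Sum>y<v. delta x y * f y) = f x"
  by (simp add: delta_def if_distrib[where f = "\<lambda>t. t * _"] cong: if_cong)

lemma sum_delta_right: "x < v \<Longrightarrow> (\<Sum>y<v. f y * delta y x) = f x"
  by (simp add: delta_def if_distrib[where f = "\<lambda>t. _ * t"] cong: if_cong)

lemma sum_delta: "x < v \<Longrightarrow> (\<Sum>y<v. delta x y) = 1" "x < v \<Longrightarrow> (\<Sum>y<v. delta y x) = 1"
  using sum_delta_left[of x v "\<lambda>_. 1"] sum_delta_right[of x v "\<lambda>_. 1"] by simp_all

lemma sum_lessThan_times:
  fixes f :: "nat \<Rightarrow> 'a::comm_monoid_add"
  shows "(\<Sum>i<k * n. f i) = (\<Sum>p<k. \<Sum>x<n. f (p * n + x))"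
proof -
  have "(\<Sum>i<k * n. f i) = (\<Sum>p<k. sum f {p * n..<p * n + n})"
    by (simp add: sum.nat_group)
  also have "\<dots> = (\<Sum>p<k. \<Sum>x<n. f (p * n + x))"
  proof (rule sum.cong[OF refl])
    fix p
    show "sum f {p * n..<p * n + n} = (\<Sum>x<n. f (p * n + x))"
      using sum.shift_bounds_nat_ivl[of f 0 "p * n" n]
      by (simp add: atLeast0LessThan add.commute)
  qed
  finally show ?thesis .
qed

lemma same_group_commute: "same_group n x y = same_group n y x"
  by (simp add: same_group_def)

lemma sum_same_group:
  assumes "x < m * n"
  shows "(\<Sum>y<m * n. same_group n x y) = of_nat n"
proof -
  have n: "n > 0" "x div n < m" using assms by (auto simp: less_mult_imp_div_less intro: Nat.gr0I)
  have "(\<Sum>y<m * n. same_group n x y) = (\<Sum>p<m. \<Sum>y<n. if x div n = p then 1 else 0)"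
    unfolding sum_lessThan_times using n by (intro sum.cong refl) (simp add: same_group_def)
  also have "\<dots> = (\<Sum>p<m. if x div n = p then of_nat n else 0)"
    by (intro sum.cong) auto
  also have "\<dots> = of_nat n" using n by simp
  finally show ?thesis .
qed

lemma sum_same_group': "x < m * n \<Longrightarrow> (\<Sum>y<m * n. same_group n y x) = of_nat n"
  using sum_same_group[of x m n] by (simp add: same_group_commute[of n x])

lemma sum_same_group_mult:
  assumes "x < m * n"
  shows "(\<Sum>y<m * n. same_group n x y * same_group n y z) = of_nat n * same_group n x z"
proof -
  have "(\<Sum>y<m * n. same_group n x y * same_group n y z) =
      (\<Sum>y<m * n. same_group n x y * same_group n x z)"
    by (intro sum.cong) (auto simp: same_group_def)
  then show ?thesis using sum_same_group[OF assms] by (simp add: sum_distrib_right[symmetric])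
qed

text \<open>One bilinear expansion serves all the products below. A combination with fewer terms is
  an instance in which the missing function is \<open>\<lambda>_. 0\<close> with coefficient
  0.\<close>

lemma sum_lincomb3_mult:
  fixes f g f' g' :: "nat \<Rightarrow> complex"
  shows "(\<Sum>y<v. (\<alpha> * f y + \<beta> * g y + \<gamma>) * (\<alpha>' * f' y + \<beta>' * g' y + \<gamma>')) =
    \<alpha> * \<alpha>' * (\<Sum>y<v. f y * f' y) + \<alpha> * \<beta>' * (\<Sum>y<v. f y * g' y) + \<alpha> * \<gamma>' * (\<Sum>y<v. f y) +
    \<beta> * \<alpha>' * (\<Sum>y<v. g y * f' y) + \<beta> * \<beta>' * (\<Sum>y<v. g y * g' y) + \<beta> * \<gamma>' * (\<Sum>y<v. g y) +
    \<gamma> * \<alpha>' * (\<Sum>y<v. f' y) + \<gamma> * \<beta>' * (\<Sum>y<v. g' y) + \<gamma> * \<gamma>' * of_nat v"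
  by (simp add: algebra_simps sum.distrib sum_distrib_left)

text \<open>The general element of the span of I, G and J, which is closed under products by G^2 = n
  G, G J = J G = n J and J^2 = m n J.\<close>

definition group_comb :: "nat \<Rightarrow> nat \<Rightarrow> complex \<Rightarrow> complex \<Rightarrow> complex \<Rightarrow> complex mat" where
  "group_comb m n \<alpha> \<beta> \<gamma> = mat (m * n) (m * n) (\<lambda>(x, y). \<alpha> * delta x y + \<beta> * same_group n x y + \<gamma>)"

text \<open>The shape of an off-diagonal block, a A + b J. No term in G is needed: multiplying A by
  G or J yields only multiples of J.\<close>

definition ones_comb :: "nat \<Rightarrow> complex mat \<Rightarrow> complex \<Rightarrow> complex \<Rightarrow> complex mat" where
  "ones_comb v A a b = mat v v (\<lambda>(x, y). a * A $$ (x, y) + b)"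

lemma group_comb_carrier [simp]: "group_comb m n \<alpha> \<beta> \<gamma> \<in> carrier_mat (m * n) (m * n)"
  by (simp add: group_comb_def)

lemma ones_comb_carrier [simp]: "ones_comb v A a b \<in> carrier_mat v v"
  by (simp add: ones_comb_def)

lemma group_comb_index: "x < m * n \<Longrightarrow> y < m * n \<Longrightarrow>
    group_comb m n \<alpha> \<beta> \<gamma> $$ (x, y) = \<alpha> * delta x y + \<beta> * same_group n x y + \<gamma>"
  by (simp add: group_comb_def)

lemma ones_comb_index: "x < v \<Longrightarrow> y < v \<Longrightarrow> ones_comb v A a b $$ (x, y) = a * A $$ (x, y) + b"
  by (simp add: ones_comb_def)

lemma mult_mat_eqI:
  assumes "A \<in> carrier_mat N N" "B \<in> carrier_mat N N" "C \<in> carrier_mat N N"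
    and "\<And>x z. x < N \<Longrightarrow> z < N \<Longrightarrow> (\<Sum>y<N. A $$ (x, y) * B $$ (y, z)) = C $$ (x, z)"
  shows "A * B = C"
  using assms by (intro eq_matI) (auto simp: scalar_prod_def atLeast0LessThan)

lemma group_comb_mult:
  "group_comb m n \<alpha> \<beta> \<gamma> * group_comb m n \<alpha>' \<beta>' \<gamma>' =
    group_comb m n (\<alpha> * \<alpha>') (\<alpha> * \<beta>' + \<beta> * \<alpha>' + of_nat n * \<beta> * \<beta>')
      (\<alpha> * \<gamma>' + \<gamma> * \<alpha>' + of_nat n * (\<beta> * \<gamma>' + \<gamma> * \<beta>') + of_nat (m * n) * \<gamma> * \<gamma>')"
proof (rule mult_mat_eqI[of _ "m * n"])
  fix x z assume xz: "x < m * n" "z < m * n"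
  then show "(\<Sum>y<m * n. group_comb m n \<alpha> \<beta> \<gamma> $$ (x, y) * group_comb m n \<alpha>' \<beta>' \<gamma>' $$ (y, z)) =
    group_comb m n (\<alpha> * \<alpha>') (\<alpha> * \<beta>' + \<beta> * \<alpha>' + of_nat n * \<beta> * \<beta>')
      (\<alpha> * \<gamma>' + \<gamma> * \<alpha>' + of_nat n * (\<beta> * \<gamma>' + \<gamma> * \<beta>') + of_nat (m * n) * \<gamma> * \<gamma>') $$ (x, z)"
    by (simp add: group_comb_index sum_lincomb3_mult sum_delta_left sum_delta_right sum_delta
        sum_same_group sum_same_group' sum_same_group_mult
        del: of_nat_mult)
      (simp add: algebra_simps)
qed auto

text \<open>The constants record A A^T = A^T A = c0 I + c1 G + c2 J. Row and column conditions are
  listed side by side so that the locale is invariant under transposition, and each product formula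
  for A also holds for the block A^T.\<close>

locale gdd_incidence =
  fixes m n :: nat and k c0 c1 c2 :: complex and A :: "complex mat"
  assumes A: "A \<in> carrier_mat (m * n) (m * n)"
    and row: "x < m * n \<Longrightarrow> (\<Sum>y<m * n. A $$ (x, y)) = k"
    and col: "x < m * n \<Longrightarrow> (\<Sum>y<m * n. A $$ (y, x)) = k"
    and row_group: "x < m * n \<Longrightarrow> z < m * n \<Longrightarrow>
      (\<Sum>y<m * n. A $$ (x, y) * same_group n y z) = k / of_nat m"
    and col_group: "x < m * n \<Longrightarrow> z < m * n \<Longrightarrow>
      (\<Sum>y<m * n. same_group n x y * A $$ (y, z)) = k / of_nat m"
    and row_row: "x < m * n \<Longrightarrow> z < m * n \<Longrightarrow>
      (\<Sum>y<m * n. A $$ (x, y) * A $$ (z, y)) = c0 * delta x z + c1 * same_group n x z + c2"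
    and col_col: "x < m * n \<Longrightarrow> z < m * n \<Longrightarrow>
      (\<Sum>y<m * n. A $$ (y, x) * A $$ (y, z)) = c0 * delta x z + c1 * same_group n x z + c2"
begin

lemma group_comb_ones_comb:
  "group_comb m n \<alpha> \<beta> \<gamma> * ones_comb (m * n) A a b =
    ones_comb (m * n) A (\<alpha> * a)
      (\<alpha> * b + k / of_nat m * \<beta> * a + of_nat n * \<beta> * b + k * \<gamma> * a + of_nat (m * n) * \<gamma> * b)"
proof (rule mult_mat_eqI[of _ "m * n"])
  fix x z assume xz: "x < m * n" "z < m * n"
  then show "(\<Sum>y<m * n. group_comb m n \<alpha> \<beta> \<gamma> $$ (x, y) * ones_comb (m * n) A a b $$ (y, z)) =
    ones_comb (m * n) A (\<alpha> * a)
      (\<alpha> * b + k / of_nat m * \<beta> * a + of_nat n * \<beta> * b + k * \<gamma> * a + of_nat (m * n) * \<gamma> * b) $$ (x, z)"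
    using sum_lincomb3_mult[of \<alpha> "delta x" \<beta> "same_group n x" \<gamma> a "\<lambda>y. A $$ (y, z)" 0 "\<lambda>_. 0" b "m * n"]
    by (simp add: group_comb_index ones_comb_index sum_delta_left sum_delta_right sum_delta
        sum_same_group row col row_group col_group algebra_simps
        del: of_nat_mult)
qed auto

lemma ones_comb_group_comb:
  "ones_comb (m * n) A a b * group_comb m n \<alpha> \<beta> \<gamma> =
    ones_comb (m * n) A (\<alpha> * a)
      (\<alpha> * b + k / of_nat m * \<beta> * a + of_nat n * \<beta> * b + k * \<gamma> * a + of_nat (m * n) * \<gamma> * b)"
proof (rule mult_mat_eqI[of _ "m * n"])
  fix x z assume xz: "x < m * n" "z < m * n"
  then show "(\<Sum>y<m * n. ones_comb (m * n) A a b $$ (x, y) * group_comb m n \<alpha> \<beta> \<gamma> $$ (y, z)) =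
    ones_comb (m * n) A (\<alpha> * a)
      (\<alpha> * b + k / of_nat m * \<beta> * a + of_nat n * \<beta> * b + k * \<gamma> * a + of_nat (m * n) * \<gamma> * b) $$ (x, z)"
    using sum_lincomb3_mult[of a "\<lambda>y. A $$ (x, y)" 0 "\<lambda>_. 0" b \<alpha> "\<lambda>y. delta y z" \<beta> "\<lambda>y. same_group n y z" \<gamma> "m * n"]
    by (simp add: group_comb_index ones_comb_index sum_delta_left sum_delta_right sum_delta
        sum_same_group' row col row_group col_group
        del: of_nat_mult)
qed auto

lemma ones_comb_ones_comb:
  "ones_comb (m * n) A a b * ones_comb (m * n) (transpose_mat A) a' b' =
    group_comb m n (a * a' * c0) (a * a' * c1)
      (a * a' * c2 + k * (a * b' + b * a') + of_nat (m * n) * b * b')"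
proof (rule mult_mat_eqI[of _ "m * n"])
  fix x z assume xz: "x < m * n" "z < m * n"
  then show "(\<Sum>y<m * n. ones_comb (m * n) A a b $$ (x, y) * ones_comb (m * n) (transpose_mat A) a' b' $$ (y, z)) =
    group_comb m n (a * a' * c0) (a * a' * c1)
      (a * a' * c2 + k * (a * b' + b * a') + of_nat (m * n) * b * b') $$ (x, z)"
    using A sum_lincomb3_mult[of a "\<lambda>y. A $$ (x, y)" 0 "\<lambda>_. 0" b a' "\<lambda>y. A $$ (z, y)" 0 "\<lambda>_. 0" b' "m * n"]
    by (simp add: group_comb_index ones_comb_index row col row_row
        del: of_nat_mult)
      (simp add: algebra_simps)
qed auto

lemma transpose: "gdd_incidence m n k c0 c1 c2 (transpose_mat A)"
proof
  show "transpose_mat A \<in> carrier_mat (m * n) (m * n)" using A by simp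
qed (use A row col row_group col_group row_row col_col in
    \<open>auto simp: same_group_commute[of n _ ] mult.commute\<close>)

end

section \<open>Block matrices of order \<open>4v\<close>\<close>

text \<open>The index of point \<open>x\<close> in the outer \<open>2 \<times> 2\<close> block \<open>p\<close> and the Kronecker block \<open>q\<close> inside it.\<close>

definition block_pos :: "nat \<Rightarrow> nat \<Rightarrow> nat \<Rightarrow> nat \<Rightarrow> nat" where
  "block_pos v p q x = (2 * p + q) * v + x"

lemma block_pos_less: "p < 2 \<Longrightarrow> q < 2 \<Longrightarrow> x < v \<Longrightarrow> block_pos v p q x < 4 * v"
proof -
  assume "p < 2" "q < 2" "x < v"
  then have "2 * p + q \<le> 3" by simp
  then have "(2 * p + q) * v \<le> 3 * v" by (rule mult_le_mono1)
  then show ?thesis using \<open>x < v\<close> unfolding block_pos_def by linarith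
qed

lemma block_pos_div_mod:
  assumes "q < 2" "x < v"
  shows "block_pos v p q x div (2 * v) = p" "block_pos v p q x div v mod 2 = q" "block_pos v p q x mod v = x"
proof -
  have "block_pos v p q x div v = 2 * p + q" using assms by (simp add: block_pos_def)
  then show "block_pos v p q x div v mod 2 = q" "block_pos v p q x div (2 * v) = p"
    using assms by (simp_all add: div_mult2_eq mult.commute[of 2 v])
  show "block_pos v p q x mod v = x" using assms by (simp add: block_pos_def)
qed

lemma less_4_block_pos:
  assumes "i < 4 * v"
  obtains p q x where "p < 2" "q < 2" "x < v" "i = block_pos v p q x"
proof -
  have v: "v > 0" using assms by (intro Nat.gr0I) auto
  have "i div v < 4" using assms by (simp add: less_mult_imp_div_less)
  then have "i div v div 2 < 2" by (simp add: less_mult_imp_div_less)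
  moreover have "i = block_pos v (i div v div 2) (i div v mod 2) (i mod v)"
    by (simp add: block_pos_def)
  ultimately show thesis using that v by (metis mod_less_divisor pos2)
qed

lemma sum_block_pos:
  fixes f :: "nat \<Rightarrow> 'a::comm_monoid_add"
  shows "(\<Sum>i<4 * v. f i) = (\<Sum>x<v. f (block_pos v 0 0 x)) + (\<Sum>x<v. f (block_pos v 0 1 x)) +
    (\<Sum>x<v. f (block_pos v 1 0 x)) + (\<Sum>x<v. f (block_pos v 1 1 x))"
  unfolding sum_lessThan_times block_pos_def by (simp add: eval_nat_numeral add.assoc)

lemma mat4_eqI:
  assumes "A \<in> carrier_mat (4 * v) (4 * v)" "B \<in> carrier_mat (4 * v) (4 * v)"
    and "\<And>p q x p' q' x'. p < 2 \<Longrightarrow> q < 2 \<Longrightarrow> x < v \<Longrightarrow> p' < 2 \<Longrightarrow> q' < 2 \<Longrightarrow> x' < v \<Longrightarrow>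
      A $$ (block_pos v p q x, block_pos v p' q' x') = B $$ (block_pos v p q x, block_pos v p' q' x')"
  shows "A = B"
proof (rule eq_matI)
  fix i j assume "i < dim_row B" "j < dim_col B"
  then have "i < 4 * v" "j < 4 * v" using assms(2) by auto
  then show "A $$ (i, j) = B $$ (i, j)" by (elim less_4_block_pos) (simp add: assms(3))
qed (use assms in auto)

lemma less_2_times: "q < 2 \<Longrightarrow> x < v \<Longrightarrow> q * v + x < 2 * (v::nat)"
  by (cases q) auto

lemma kron_index:
  assumes "M \<in> carrier_mat 2 2" "X \<in> carrier_mat v v" "q < 2" "x < v" "q' < 2" "x' < v"
  shows "(M \<Otimes> X) $$ (q * v + x, q' * v + x') = M $$ (q, q') * X $$ (x, x')"
  using assms less_2_times[of q x v] less_2_times[of q' x' v] by (simp add: kron_def)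

lemma kron_carrier: "M \<in> carrier_mat 2 2 \<Longrightarrow> X \<in> carrier_mat v v \<Longrightarrow> M \<Otimes> X \<in> carrier_mat (2 * v) (2 * v)"
  by (simp add: kron_def)

lemma block_diag_index:
  assumes "X \<in> carrier_mat (2 * v) (2 * v)" "p < 2" "q < 2" "x < v" "p' < 2" "q' < 2" "x' < v"
  shows "block_diag X $$ (block_pos v p q x, block_pos v p' q' x') =
    (if p = p' then X $$ (q * v + x, q' * v + x') else 0)"
  using assms less_2_times[of q x v] less_2_times[of q' x' v]
  by (auto simp: block_diag_def block_pos_def less_2_cases_iff algebra_simps)

lemma block_antidiag_index:
  assumes "X \<in> carrier_mat (2 * v) (2 * v)" "Y \<in> carrier_mat (2 * v) (2 * v)"
    and "p < 2" "q < 2" "x < v" "p' < 2" "q' < 2" "x' < v"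
  shows "block_antidiag X Y $$ (block_pos v p q x, block_pos v p' q' x') =
    (if p = p' then 0 else (if p = 0 then X else Y) $$ (q * v + x, q' * v + x'))"
  using assms less_2_times[of q x v] less_2_times[of q' x' v]
  by (auto simp: block_antidiag_def block_pos_def less_2_cases_iff algebra_simps)

text \<open>The block matrix with blocks \<open>S \<Otimes> D\<close>, \<open>S \<Otimes> Y\<close>, \<open>S \<Otimes> Z\<close>, \<open>S \<Otimes> D\<close>, where \<open>S\<close> is the
  matrix with rows \<open>1, s\<close> and \<open>s, 1\<close>.\<close>

definition sign_block :: "nat \<Rightarrow> complex \<Rightarrow> complex mat \<Rightarrow> complex mat \<Rightarrow> complex mat \<Rightarrow> complex mat" where
  "sign_block v s D Y Z = mat (4 * v) (4 * v) (\<lambda>(i, j).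
     (if i div v mod 2 = j div v mod 2 then 1 else s) *
     (if i div (2 * v) = j div (2 * v) then D else if i div (2 * v) = 0 then Y else Z) $$ (i mod v, j mod v))"

lemma sign_block_carrier [simp]: "sign_block v s D Y Z \<in> carrier_mat (4 * v) (4 * v)"
  by (simp add: sign_block_def)

lemma sign_block_index:
  assumes "p < 2" "q < 2" "x < v" "p' < 2" "q' < 2" "x' < v"
  shows "sign_block v s D Y Z $$ (block_pos v p q x, block_pos v p' q' x') =
    (if q = q' then 1 else s) * (if p = p' then D else if p = 0 then Y else Z) $$ (x, x')"
  using assms by (simp add: sign_block_def block_pos_div_mod block_pos_less)

text \<open>For s^2 = 1 the sign matrix S satisfies S^2 = 2 S, and it is annihilated by the sign
  matrix of -s: these are J_2 and I_2 - \<Pi>, the two characters. The condition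
  \<open>Y * Z' = Z * Y'\<close> makes the two diagonal blocks of the product agree, as the format
  of \<open>sign_block\<close> demands.\<close>

lemma sign_block_mult:
  assumes car: "D \<in> carrier_mat v v" "Y \<in> carrier_mat v v" "Z \<in> carrier_mat v v"
    "D' \<in> carrier_mat v v" "Y' \<in> carrier_mat v v" "Z' \<in> carrier_mat v v"
    and s: "s * s = 1"
  shows "Y * Z' = Z * Y' \<Longrightarrow> sign_block v s D Y Z * sign_block v s D' Y' Z' =
    2 \<cdot>\<^sub>m sign_block v s (D * D' + Y * Z') (D * Y' + Y * D') (D * Z' + Z * D')"
    "sign_block v s D Y Z * sign_block v (- s) D' Y' Z' = 0\<^sub>m (4 * v) (4 * v)"
proof -
  \<comment> \<open>The sum over the middle index factors: the scalar is an entry of the product of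
    the two sign matrices, and the two remaining sums run over the middle outer block.\<close>
  have 1: "(sign_block v s D Y Z * sign_block v t D' Y' Z') $$ (block_pos v p q x, block_pos v p' q' x') =
     ((if q = 0 then 1 else s) * (if q' = 0 then 1 else t) + (if q = 1 then 1 else s) * (if q' = 1 then 1 else t)) *
      ((\<Sum>y<v. (if p = 0 then D else Z) $$ (x, y) * (if p' = 0 then D' else Y') $$ (y, x')) +
       (\<Sum>y<v. (if p = 1 then D else Y) $$ (x, y) * (if p' = 1 then D' else Z') $$ (y, x')))"
    if "p < 2" "q < 2" "x < v" "p' < 2" "q' < 2" "x' < v" for t p q x p' q' x'
  proof -
    have "(sign_block v s D Y Z * sign_block v t D' Y' Z') $$ (block_pos v p q x, block_pos v p' q' x') =
      (\<Sum>i<4 * v. sign_block v s D Y Z $$ (block_pos v p q x, i) * sign_block v t D' Y' Z' $$ (i, block_pos v p' q' x'))"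
      using that block_pos_less by (simp add: scalar_prod_def atLeast0LessThan sign_block_def)
    then show ?thesis
      using that unfolding sum_block_pos less_2_cases_iff
      by (auto simp: sign_block_index sum_distrib_left algebra_simps)
  qed
  have s': "s = 1 \<or> s = -1" using s by (simp add: square_eq_1_iff)
  show "sign_block v s D Y Z * sign_block v s D' Y' Z' =
    2 \<cdot>\<^sub>m sign_block v s (D * D' + Y * Z') (D * Y' + Y * D') (D * Z' + Z * D')"
    if eq: "Y * Z' = Z * Y'"
  proof (rule mat4_eqI)
    have eq': "(\<Sum>y<v. Y $$ (x, y) * Z' $$ (y, x')) = (\<Sum>y<v. Z $$ (x, y) * Y' $$ (y, x'))"
      if "x < v" "x' < v" for x x'
      using arg_cong[OF eq, of "\<lambda>M. M $$ (x, x')"] car that by (simp add: scalar_prod_def atLeast0LessThan)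
    fix p q x p' q' x' assume *: "p < (2::nat)" "q < (2::nat)" "x < v" "p' < (2::nat)" "q' < (2::nat)" "x' < v"
    show "(sign_block v s D Y Z * sign_block v s D' Y' Z') $$ (block_pos v p q x, block_pos v p' q' x') =
      (2 \<cdot>\<^sub>m sign_block v s (D * D' + Y * Z') (D * Y' + Y * D') (D * Z' + Z * D')) $$ (block_pos v p q x, block_pos v p' q' x')"
      unfolding 1[OF *]
      using * s' car block_pos_less[OF *(1-3)] block_pos_less[OF *(4-6)] sign_block_carrier[THEN carrier_matD(1)]
        sign_block_carrier[THEN carrier_matD(2)]
      by (auto simp: sign_block_index less_2_cases_iff scalar_prod_def atLeast0LessThan eq' add.commute)
  qed (auto intro!: mult_carrier_mat[of _ _ "4 * v"])
  show "sign_block v s D Y Z * sign_block v (- s) D' Y' Z' = 0\<^sub>m (4 * v) (4 * v)"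
  proof (rule mat4_eqI)
    fix p q x p' q' x' assume *: "p < (2::nat)" "q < (2::nat)" "x < v" "p' < (2::nat)" "q' < (2::nat)" "x' < v"
    show "(sign_block v s D Y Z * sign_block v (- s) D' Y' Z') $$ (block_pos v p q x, block_pos v p' q' x') =
      0\<^sub>m (4 * v) (4 * v) $$ (block_pos v p q x, block_pos v p' q' x')"
      unfolding 1[OF *] using * s' block_pos_less[OF *(1-3)] block_pos_less[OF *(4-6)]
      by (auto simp: less_2_cases_iff)
  qed (auto intro!: mult_carrier_mat[of _ _ "4 * v"])
qed

lemma le_6_cases: "i \<le> (6::nat) \<Longrightarrow> i = 0 \<or> i = 1 \<or> i = 2 \<or> i = 3 \<or> i = 4 \<or> i = 5 \<or> i = 6"
  by arith

lemma sum_atMost_6: "(\<Sum>i\<le>6. f i) = f 0 + f 1 + f 2 + f 3 + f 4 + f 5 + f (6::nat)"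
  by (simp add: eval_nat_numeral)

lemma sign_block_smult:
  assumes "D \<in> carrier_mat v v" "Y \<in> carrier_mat v v" "Z \<in> carrier_mat v v"
  shows "c \<cdot>\<^sub>m sign_block v s D Y Z = sign_block v s (c \<cdot>\<^sub>m D) (c \<cdot>\<^sub>m Y) (c \<cdot>\<^sub>m Z)"
proof (rule mat4_eqI)
  fix p q x p' q' x' assume *: "p < (2::nat)" "q < (2::nat)" "x < v" "p' < (2::nat)" "q' < (2::nat)" "x' < v"
  then show "(c \<cdot>\<^sub>m sign_block v s D Y Z) $$ (block_pos v p q x, block_pos v p' q' x') =
      sign_block v s (c \<cdot>\<^sub>m D) (c \<cdot>\<^sub>m Y) (c \<cdot>\<^sub>m Z) $$ (block_pos v p q x, block_pos v p' q' x')"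
    using assms block_pos_less[OF *(1-3)] block_pos_less[OF *(4-6)] sign_block_carrier[THEN carrier_matD(1)]
      sign_block_carrier[THEN carrier_matD(2)]
    by (simp add: sign_block_index)
qed auto

lemma group_comb_add: "group_comb m n \<alpha> \<beta> \<gamma> + group_comb m n \<alpha>' \<beta>' \<gamma>' = group_comb m n (\<alpha> + \<alpha>') (\<beta> + \<beta>') (\<gamma> + \<gamma>')"
  by (rule eq_matI) (auto simp: group_comb_def algebra_simps)

lemma ones_comb_add: "ones_comb v A a b + ones_comb v A a' b' = ones_comb v A (a + a') (b + b')"
  by (rule eq_matI) (auto simp: ones_comb_def algebra_simps)

lemma group_comb_smult: "c \<cdot>\<^sub>m group_comb m n \<alpha> \<beta> \<gamma> = group_comb m n (c * \<alpha>) (c * \<beta>) (c * \<gamma>)"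
  by (rule eq_matI) (auto simp: group_comb_def algebra_simps)

lemma ones_comb_smult: "c \<cdot>\<^sub>m ones_comb v A a b = ones_comb v A (c * a) (c * b)"
  by (rule eq_matI) (auto simp: ones_comb_def algebra_simps)

section \<open>The trivial part: the algebra of I, G, J and A\<close>

context gdd_incidence
begin

text \<open>The sum \<open>?S\<close> is an entry of A A^T G. The formula for A A^T gives the left
  side, while A A^T G = A (G A)^T with G A = (k/m) J and row sums k gives the right side.\<close>

lemma c_rel:
  assumes xz: "x < m * n" "z < m * n"
  shows "(c0 + of_nat n * c1) * same_group n x z + of_nat n * c2 = k^2 / of_nat m"
proof -
  let ?S = "\<Sum>y<m * n. (\<Sum>u<m * n. A $$ (x, u) * A $$ (y, u)) * same_group n y z"
  have "?S = (\<Sum>y<m * n. (c0 * delta x y + c1 * same_group n x y + c2) * same_group n y z)"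
    using row_row xz by simp
  also have "\<dots> = (c0 + of_nat n * c1) * same_group n x z + of_nat n * c2"
    using xz sum_lincomb3_mult[of c0 "delta x" c1 "same_group n x" c2 0 "\<lambda>_. 0" 1 "\<lambda>y. same_group n y z" 0 "m * n"]
    by (simp add: sum_delta_left sum_same_group_mult sum_same_group' del: of_nat_mult) (simp add: algebra_simps)
  finally have 1: "?S = (c0 + of_nat n * c1) * same_group n x z + of_nat n * c2" .
  have "?S = (\<Sum>y<m * n. \<Sum>u<m * n. A $$ (x, u) * (same_group n z y * A $$ (y, u)))"
    by (simp add: sum_distrib_right sum_distrib_left same_group_commute[of n z] algebra_simps)
  also have "\<dots> = (\<Sum>u<m * n. A $$ (x, u) * (\<Sum>y<m * n. same_group n z y * A $$ (y, u)))"
    by (subst sum.swap) (simp add: sum_distrib_left)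
  also have "\<dots> = k^2 / of_nat m"
    using xz row by (simp add: col_group sum_divide_distrib[symmetric] sum_distrib_right[symmetric] power2_eq_square)
  finally show ?thesis using 1 by simp
qed

definition ones_block :: "complex \<Rightarrow> complex \<Rightarrow> complex \<Rightarrow> complex \<Rightarrow> complex \<Rightarrow> complex mat" where
  "ones_block \<alpha> \<beta> \<gamma> a b = sign_block (m * n) 1 (group_comb m n \<alpha> \<beta> \<gamma>)
     (ones_comb (m * n) A a b) (ones_comb (m * n) (transpose_mat A) a b)"

text \<open>The five parameters are closed under multiplication; the outer factors 2 come from J_2^2
  = 2 J_2.\<close>

lemma ones_block_mult:
  "ones_block \<alpha> \<beta> \<gamma> a b * ones_block \<alpha>' \<beta>' \<gamma>' a' b' = ones_block
     (2 * (\<alpha> * \<alpha>' + c0 * a * a'))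
     (2 * (\<alpha> * \<beta>' + \<beta> * \<alpha>' + of_nat n * \<beta> * \<beta>' + c1 * a * a'))
     (2 * (\<alpha> * \<gamma>' + \<gamma> * \<alpha>' + of_nat n * (\<beta> * \<gamma>' + \<gamma> * \<beta>') + of_nat (m * n) * \<gamma> * \<gamma>' +
        c2 * a * a' + k * (a * b' + b * a') + of_nat (m * n) * b * b'))
     (2 * (\<alpha> * a' + a * \<alpha>'))
     (2 * (\<alpha> * b' + b * \<alpha>' + k / of_nat m * (\<beta> * a' + a * \<beta>') + of_nat n * (\<beta> * b' + b * \<beta>') +
        k * (\<gamma> * a' + a * \<gamma>') + of_nat (m * n) * (\<gamma> * b' + b * \<gamma>')))"
proof -
  interpret T: gdd_incidence m n k c0 c1 c2 "transpose_mat A" by (rule transpose)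
  note mults = group_comb_mult group_comb_ones_comb ones_comb_group_comb ones_comb_ones_comb
    T.group_comb_ones_comb T.ones_comb_group_comb T.ones_comb_ones_comb[unfolded transpose_transpose]
  have "ones_block \<alpha> \<beta> \<gamma> a b * ones_block \<alpha>' \<beta>' \<gamma>' a' b' =
    2 \<cdot>\<^sub>m sign_block (m * n) 1
      (group_comb m n \<alpha> \<beta> \<gamma> * group_comb m n \<alpha>' \<beta>' \<gamma>' +
        ones_comb (m * n) A a b * ones_comb (m * n) (transpose_mat A) a' b')
      (group_comb m n \<alpha> \<beta> \<gamma> * ones_comb (m * n) A a' b' + ones_comb (m * n) A a b * group_comb m n \<alpha>' \<beta>' \<gamma>')
      (group_comb m n \<alpha> \<beta> \<gamma> * ones_comb (m * n) (transpose_mat A) a' b' +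
        ones_comb (m * n) (transpose_mat A) a b * group_comb m n \<alpha>' \<beta>' \<gamma>')"
    \<comment> \<open>The side condition of \<open>sign_block_mult\<close> holds because A A^T and
      A^T A have the same expansion, so both products evaluate to the same
      \<open>group_comb\<close>.\<close>
    unfolding ones_block_def by (rule sign_block_mult(1)) (auto simp: mults)
  then show ?thesis
    unfolding mults group_comb_add ones_comb_add
    by (simp add: sign_block_smult group_comb_smult ones_comb_smult ones_block_def algebra_simps)
qed

end

section \<open>The alternating part: the algebra of I and W, and its orthogonality to the trivial
  part\<close>

lemma sign_block_cong:
  "D = D' \<Longrightarrow> Y = Y' \<Longrightarrow> Z = Z' \<Longrightarrow> sign_block v s D Y Z = sign_block v s D' Y' Z'"
  by simp

locale weighing =
  fixes v :: nat and k :: complex and W :: "complex mat"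
  assumes W: "W \<in> carrier_mat v v"
    and row_row: "x < v \<Longrightarrow> z < v \<Longrightarrow> (\<Sum>y<v. W $$ (x, y) * W $$ (z, y)) = k * delta x z"
    and col_col: "x < v \<Longrightarrow> z < v \<Longrightarrow> (\<Sum>y<v. W $$ (y, x) * W $$ (y, z)) = k * delta x z"
begin

definition alt_block :: "complex \<Rightarrow> complex \<Rightarrow> complex mat" where
  "alt_block \<alpha> a = sign_block v (- 1) (\<alpha> \<cdot>\<^sub>m 1\<^sub>m v) (a \<cdot>\<^sub>m W) (a \<cdot>\<^sub>m transpose_mat W)"

lemma W_mult: "W * transpose_mat W = k \<cdot>\<^sub>m 1\<^sub>m v" "transpose_mat W * W = k \<cdot>\<^sub>m 1\<^sub>m v"
  using W row_row col_col
  by (auto simp: scalar_prod_def atLeast0LessThan delta_def intro!: eq_matI)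

lemma alt_block_mult:
  "alt_block \<alpha> a * alt_block \<alpha>' a' = alt_block (2 * (\<alpha> * \<alpha>' + k * a * a')) (2 * (\<alpha> * a' + a * \<alpha>'))"
proof -
  note Wt = transpose_carrier_mat[THEN iffD2, OF W]
  note smult = mult_smult_assoc_mat[of _ v v _ v] mult_smult_distrib[of _ v v _ v]
  have mults: "(a \<cdot>\<^sub>m W) * (a' \<cdot>\<^sub>m transpose_mat W) = (a * a' * k) \<cdot>\<^sub>m 1\<^sub>m v"
    "(a \<cdot>\<^sub>m transpose_mat W) * (a' \<cdot>\<^sub>m W) = (a * a' * k) \<cdot>\<^sub>m 1\<^sub>m v"
    "(\<alpha> \<cdot>\<^sub>m 1\<^sub>m v) * (\<alpha>' \<cdot>\<^sub>m 1\<^sub>m v) = (\<alpha> * \<alpha>') \<cdot>\<^sub>m 1\<^sub>m v"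
    "(\<alpha> \<cdot>\<^sub>m 1\<^sub>m v) * (a' \<cdot>\<^sub>m W) = (\<alpha> * a') \<cdot>\<^sub>m W"
    "(a \<cdot>\<^sub>m W) * (\<alpha>' \<cdot>\<^sub>m 1\<^sub>m v) = (a * \<alpha>') \<cdot>\<^sub>m W"
    "(\<alpha> \<cdot>\<^sub>m 1\<^sub>m v) * (a' \<cdot>\<^sub>m transpose_mat W) = (\<alpha> * a') \<cdot>\<^sub>m transpose_mat W"
    "(a \<cdot>\<^sub>m transpose_mat W) * (\<alpha>' \<cdot>\<^sub>m 1\<^sub>m v) = (a * \<alpha>') \<cdot>\<^sub>m transpose_mat W"
    using W Wt by (auto simp: smult W_mult intro!: eq_matI)
  have "alt_block \<alpha> a * alt_block \<alpha>' a' =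
    2 \<cdot>\<^sub>m sign_block v (- 1)
      ((\<alpha> \<cdot>\<^sub>m 1\<^sub>m v) * (\<alpha>' \<cdot>\<^sub>m 1\<^sub>m v) + (a \<cdot>\<^sub>m W) * (a' \<cdot>\<^sub>m transpose_mat W))
      ((\<alpha> \<cdot>\<^sub>m 1\<^sub>m v) * (a' \<cdot>\<^sub>m W) + (a \<cdot>\<^sub>m W) * (\<alpha>' \<cdot>\<^sub>m 1\<^sub>m v))
      ((\<alpha> \<cdot>\<^sub>m 1\<^sub>m v) * (a' \<cdot>\<^sub>m transpose_mat W) + (a \<cdot>\<^sub>m transpose_mat W) * (\<alpha>' \<cdot>\<^sub>m 1\<^sub>m v))"
    unfolding alt_block_def using W Wt by (intro sign_block_mult(1)) (auto simp: mults)
  also have "\<dots> = alt_block (2 * (\<alpha> * \<alpha>' + k * a * a')) (2 * (\<alpha> * a' + a * \<alpha>'))"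
    unfolding mults alt_block_def using W Wt
    by (intro trans[OF sign_block_smult sign_block_cong]) (auto intro!: eq_matI simp: algebra_simps)
  finally show ?thesis .
qed

end

text \<open>The two parts annihilate each other because (I_2 - \<Pi>) J_2 = 0, whatever the blocks
  are.\<close>

lemma alt_block_ones_block:
  assumes "weighing (m * n) k' W" "gdd_incidence m n k c0 c1 c2 A"
  shows "weighing.alt_block (m * n) W \<alpha>' a' * gdd_incidence.ones_block m n A \<alpha> \<beta> \<gamma> a b = 0\<^sub>m (4 * (m * n)) (4 * (m * n))"
    "gdd_incidence.ones_block m n A \<alpha> \<beta> \<gamma> a b * weighing.alt_block (m * n) W \<alpha>' a' = 0\<^sub>m (4 * (m * n)) (4 * (m * n))"
proof -
  note car = weighing.W[OF assms(1)]
  show "weighing.alt_block (m * n) W \<alpha>' a' * gdd_incidence.ones_block m n A \<alpha> \<beta> \<gamma> a b = 0\<^sub>m (4 * (m * n)) (4 * (m * n))"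
    "gdd_incidence.ones_block m n A \<alpha> \<beta> \<gamma> a b * weighing.alt_block (m * n) W \<alpha>' a' = 0\<^sub>m (4 * (m * n)) (4 * (m * n))"
    unfolding weighing.alt_block_def[OF assms(1)] gdd_incidence.ones_block_def[OF assms(2)]
    using car sign_block_mult(2)[where s = "- 1" and v = "m * n"] sign_block_mult(2)[where s = "1" and v = "m * n"]
    by simp_all
qed

section \<open>The scheme of a weighing matrix\<close>

lemma swap_mat_index: "q < 2 \<Longrightarrow> q' < 2 \<Longrightarrow> swap_mat $$ (q, q') = (if q = q' then 0 else 1)"
  by (auto simp: swap_mat_def mat_of_rows_list_def less_2_cases_iff)

lemma swap_mat_carrier: "swap_mat \<in> carrier_mat 2 2"
  by (simp add: swap_mat_def mat_of_rows_list_def numeral_2_eq_2)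

lemma all_ones_carrier: "all_ones r \<in> carrier_mat r r"
  by (simp add: all_ones_def)

lemma group_ones_carrier: "group_ones m n \<in> carrier_mat (m * n) (m * n)"
  by (simp add: group_ones_def kron_def all_ones_def)

lemma all_ones_index: "x < r \<Longrightarrow> y < r \<Longrightarrow> all_ones r $$ (x, y) = 1"
  by (simp add: all_ones_def)

lemma group_ones_index:
  assumes "x < m * n" "y < m * n"
  shows "group_ones m n $$ (x, y) = same_group n x y"
proof -
  have "n > 0" using assms by (intro Nat.gr0I) auto
  then show ?thesis
    using assms by (simp add: group_ones_def kron_def all_ones_def same_group_def less_mult_imp_div_less)
qed

lemma block_pos_eq_iff:
  assumes "p < 2" "q < 2" "x < v" "p' < 2" "q' < 2" "x' < v"
  shows "block_pos v p q x = block_pos v p' q' x' \<longleftrightarrow> p = p' \<and> q = q' \<and> x = x'"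
  using assms by (metis block_pos_div_mod)

section \<open>Numerical consequences of the hypotheses on W\<close>

locale gdd_weighing =
  fixes m n k l1 l2 :: nat and W W1 W2 :: "complex mat"
  assumes weighing: "weighing_matrix (m * n) k W"
    and gdd: "symmetric_gdd (m * n) k m n l1 l2 (abs_mat W)"
    and k_pos: "k > 0"
    and abs_group: "abs_mat W * group_ones m n = (of_nat k / of_nat m) \<cdot>\<^sub>m all_ones (m * n)"
    and group_abs: "group_ones m n * abs_mat W = (of_nat k / of_nat m) \<cdot>\<^sub>m all_ones (m * n)"
    and W1: "W1 \<in> carrier_mat (m * n) (m * n)" and W2: "W2 \<in> carrier_mat (m * n) (m * n)"
    and W1_01: "zero_one_mat W1" and W2_01: "zero_one_mat W2"
    and disj: "disjoint_mats W1 W2"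
    and W_eq: "W = W1 - W2"
    and k_less: "k < m * n"
begin

abbreviation "v \<equiv> m * n"
abbreviation "A \<equiv> abs_mat W"

lemma mn: "2 \<le> m" "2 \<le> n"
  using gdd by (auto simp: symmetric_gdd_def)

lemma W: "W \<in> carrier_mat v v"
  using W1 W2 W_eq by auto

lemma A: "A \<in> carrier_mat v v"
  using W by (simp add: abs_mat_def)

lemma W12_cases:
  assumes "x < v" "y < v"
  shows "W1 $$ (x, y) = 0 \<and> W2 $$ (x, y) = 0 \<or> W1 $$ (x, y) = 1 \<and> W2 $$ (x, y) = 0 \<or>
    W1 $$ (x, y) = 0 \<and> W2 $$ (x, y) = 1"
proof -
  have "W1 $$ (x, y) \<in> {0, 1}" "W2 $$ (x, y) \<in> {0, 1}" "W1 $$ (x, y) = 0 \<or> W2 $$ (x, y) = 0"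
    using assms W1 W2 W1_01 W2_01 disj by (auto simp: zero_one_mat_index disjoint_mats_def)
  then show ?thesis by blast
qed

lemma W_index: "x < v \<Longrightarrow> y < v \<Longrightarrow> W $$ (x, y) = W1 $$ (x, y) - W2 $$ (x, y)"
  using W1 W2 by (simp add: W_eq)

lemma A_index:
  assumes "x < v" "y < v"
  shows "A $$ (x, y) = W1 $$ (x, y) + W2 $$ (x, y)"
proof -
  have "A $$ (x, y) = complex_of_real (cmod (W1 $$ (x, y) - W2 $$ (x, y)))"
    using assms W W_index by (simp add: abs_mat_def)
  moreover have "complex_of_real (cmod (W1 $$ (x, y) - W2 $$ (x, y))) = W1 $$ (x, y) + W2 $$ (x, y)"
    using W12_cases[OF assms] by auto
  ultimately show ?thesis by simp
qed

lemma A_transpose: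
  "A * transpose_mat A = of_nat k \<cdot>\<^sub>m 1\<^sub>m v + of_nat l1 \<cdot>\<^sub>m (group_ones m n - 1\<^sub>m v)
    + of_nat l2 \<cdot>\<^sub>m (all_ones v - group_ones m n)"
  "transpose_mat A * A = of_nat k \<cdot>\<^sub>m 1\<^sub>m v + of_nat l1 \<cdot>\<^sub>m (group_ones m n - 1\<^sub>m v)
    + of_nat l2 \<cdot>\<^sub>m (all_ones v - group_ones m n)"
  using gdd by (auto simp: symmetric_gdd_def)

lemma sum_A_group:
  assumes "x < v" "z < v"
  shows "(\<Sum>y<v. A $$ (x, y) * same_group n y z) = of_nat k / of_nat m"
    "(\<Sum>y<v. same_group n x y * A $$ (y, z)) = of_nat k / of_nat m"
  using arg_cong[OF abs_group, of "\<lambda>M. M $$ (x, z)"] arg_cong[OF group_abs, of "\<lambda>M. M $$ (x, z)"]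
    assms A group_ones_carrier[of m n] all_ones_carrier[of v]
  by (simp_all add: scalar_prod_def atLeast0LessThan group_ones_index all_ones_index)

text \<open>Summing a row of A G = (k/m) J counts every entry of that row of A exactly n times, and
  the total is v k / m = n k; columns are treated likewise with G A.\<close>

lemma sum_A:
  assumes "x < v"
  shows "(\<Sum>y<v. A $$ (x, y)) = of_nat k" "(\<Sum>y<v. A $$ (y, x)) = of_nat k"
proof -
  have nz: "of_nat m \<noteq> (0::complex)" "of_nat n \<noteq> (0::complex)" using mn by auto
  have "(\<Sum>z<v. \<Sum>y<v. A $$ (x, y) * same_group n y z) = of_nat v * (of_nat k / of_nat m)"
    using assms by (simp add: sum_A_group)
  moreover have "(\<Sum>z<v. \<Sum>y<v. A $$ (x, y) * same_group n y z) = (\<Sum>y<v. A $$ (x, y)) * of_nat n"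
    by (subst sum.swap) (simp add: sum_distrib_left[symmetric] sum_distrib_right sum_same_group)
  ultimately show "(\<Sum>y<v. A $$ (x, y)) = of_nat k" using nz by simp
  have "(\<Sum>z<v. \<Sum>y<v. same_group n z y * A $$ (y, x)) = of_nat v * (of_nat k / of_nat m)"
    using assms by (simp add: sum_A_group)
  moreover have "(\<Sum>z<v. \<Sum>y<v. same_group n z y * A $$ (y, x)) = of_nat n * (\<Sum>y<v. A $$ (y, x))"
    by (subst sum.swap) (simp add: sum_distrib_right[symmetric] sum_distrib_left sum_same_group')
  ultimately show "(\<Sum>y<v. A $$ (y, x)) = of_nat k" using nz by simp
qed

lemma incidence: "gdd_incidence m n (of_nat k) (of_nat k - of_nat l1) (of_nat l1 - of_nat l2) (of_nat l2) A"
proof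
  fix x z assume xz: "x < v" "z < v"
  show "(\<Sum>y<v. A $$ (x, y) * A $$ (z, y)) =
      (of_nat k - of_nat l1) * delta x z + (of_nat l1 - of_nat l2) * same_group n x z + of_nat l2"
    using arg_cong[OF A_transpose(1), of "\<lambda>M. M $$ (x, z)"] xz
      A group_ones_carrier[of m n] all_ones_carrier[of v]
    by (simp add: scalar_prod_def atLeast0LessThan group_ones_index all_ones_index delta_def algebra_simps)
  show "(\<Sum>y<v. A $$ (y, x) * A $$ (y, z)) =
      (of_nat k - of_nat l1) * delta x z + (of_nat l1 - of_nat l2) * same_group n x z + of_nat l2"
    using arg_cong[OF A_transpose(2), of "\<lambda>M. M $$ (x, z)"] xz
      A group_ones_carrier[of m n] all_ones_carrier[of v]
    by (simp add: scalar_prod_def atLeast0LessThan group_ones_index all_ones_index delta_def algebra_simps)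
qed (use A sum_A sum_A_group in auto)

definition r :: real where "r = sqrt (real k * (real m * real n - real k)) / sqrt (real m * (real n - 1))"

lemma real_pos: "real m > 0" "real n > 1" "real k > 0" "real m * real n - real k > 0"
proof -
  show "real m > 0" "real n > 1" "real k > 0" using mn k_pos by auto
  have "real k < real (m * n)" using k_less by (rule of_nat_less_iff[THEN iffD2])
  then show "real m * real n - real k > 0" by simp
qed

text \<open>This rests on k < v. Positivity matters because two of the idempotents have
  \<open>r\<close> in a denominator.\<close>

lemma r_pos: "r > 0"
  using real_pos by (simp add: r_def)

lemma r_square: "r^2 * (real m * (real n - 1)) = real k * (real m * real n - real k)"
  using real_pos by (simp add: r_def power_divide)

text \<open>\<open>c_rel\<close> at the pair (0, 0) and at the pair (0, n), whose points lie in
  different groups, gives n l2 = k^2 / m and (k - l1) + n (l1 - l2) = 0, from which l1 and l2 are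
  determined.\<close>

lemma coefficients:
  "of_nat k - of_nat l1 = complex_of_real (r^2)"
  "of_nat l1 - of_nat l2 = complex_of_real (- (r^2) / real n)"
  "of_nat l2 = complex_of_real ((real k)^2 / (real m * real n))"
proof -
  interpret gdd_incidence m n "of_nat k" "of_nat k - of_nat l1" "of_nat l1 - of_nat l2" "of_nat l2" A
    by (rule incidence)
  \<comment> \<open>With at least two groups, n is a point, namely the first one of the second
    group.\<close>
  have "2 * n \<le> v" using mn by simp
  then have n: "n < v" "0 < v" using mn by linarith+
  have sg: "same_group n 0 0 = 1" "same_group n 0 n = 0" using mn by (auto simp: same_group_def)
  have "complex_of_real (real k - real l1 + real n * (real l1 - real l2) + real n * real l2) = complex_of_real (real k^2 / real m)"
    using c_rel[of 0 0] n sg by simp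
  then have 1: "real k - real l1 + real n * (real l1 - real l2) + real n * real l2 = real k^2 / real m"
    unfolding of_real_eq_iff .
  have "complex_of_real (real n * real l2) = complex_of_real (real k^2 / real m)"
    using c_rel[of 0 n] n sg by simp
  then have 2: "real n * real l2 = real k^2 / real m"
    unfolding of_real_eq_iff .
  have 3: "real l2 = real k^2 / (real m * real n)" using 2 real_pos by (simp add: field_simps)
  have "real n * (real l1 - real l2) = - (real k - real l1)" using 1 2 by simp
  then have 4: "real l1 - real l2 = - (real k - real l1) / real n"
    using real_pos by (simp add: field_simps)
  \<comment> \<open>In fact \<open>1\<close> the parameter l2 cancels, leaving k + (n - 1) l1 = k^2
    / m.\<close>
  have "(real k - real l1) * (real m * (real n - 1)) = r^2 * (real m * (real n - 1))"
    unfolding r_square using 1 real_pos by (simp add: field_simps power2_eq_square)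
  then have 5: "real k - real l1 = r^2" using real_pos by simp
  show "of_nat k - of_nat l1 = complex_of_real (r^2)" unfolding 5[symmetric] by simp
  show "of_nat l1 - of_nat l2 = complex_of_real (- (r^2) / real n)" unfolding 5[symmetric] 4[symmetric] by simp
  show "of_nat l2 = complex_of_real ((real k)^2 / (real m * real n))" unfolding 3[symmetric] by simp
qed

sublocale I: gdd_incidence m n "of_nat k" "complex_of_real (r^2)" "complex_of_real (- (r^2) / real n)"
  "complex_of_real ((real k)^2 / (real m * real n))" A
  \<comment> \<open>\<open>coefficients(3)\<close> has to come last: rewriting
    \<open>of_nat l2\<close> earlier would destroy the left side of
    \<open>coefficients(2)\<close>.\<close>
  using incidence unfolding coefficients(1,2) unfolding coefficients(3) .

sublocale V: weighing v "of_nat k" W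
proof
  have WWt: "W * transpose_mat W = of_nat k \<cdot>\<^sub>m 1\<^sub>m v" using weighing by (simp add: weighing_matrix_def)
  have Wt: "transpose_mat W \<in> carrier_mat v v" using W by simp
  have k: "of_nat k \<noteq> (0::complex)" using k_pos by simp
  \<comment> \<open>The definition of a weighing matrix gives only W W^T = k I. A one-sided inverse
    of a square matrix is two-sided, whence W^T W = k I.\<close>
  have "W * ((1 / of_nat k) \<cdot>\<^sub>m transpose_mat W) = 1\<^sub>m v"
    using k by (subst mult_smult_distrib[OF W Wt]) (auto simp: WWt intro!: eq_matI)
  then have "((1 / of_nat k) \<cdot>\<^sub>m transpose_mat W) * W = 1\<^sub>m v"
    by (rule mat_mult_left_right_inverse[OF W smult_carrier_mat[OF Wt]])
  then have "(1 / of_nat k) \<cdot>\<^sub>m (transpose_mat W * W) = 1\<^sub>m v"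
    by (subst (asm) mult_smult_assoc_mat[OF Wt W])
  moreover have "of_nat k \<cdot>\<^sub>m ((1 / of_nat k) \<cdot>\<^sub>m (transpose_mat W * W)) = transpose_mat W * W"
    using k by (intro eq_matI) auto
  ultimately have WtW: "transpose_mat W * W = of_nat k \<cdot>\<^sub>m 1\<^sub>m v" by simp
  fix x z assume xz: "x < v" "z < v"
  show "(\<Sum>y<v. W $$ (x, y) * W $$ (z, y)) = of_nat k * delta x z"
    using arg_cong[OF WWt, of "\<lambda>M. M $$ (x, z)"] xz W
    by (simp add: scalar_prod_def atLeast0LessThan delta_def)
  show "(\<Sum>y<v. W $$ (y, x) * W $$ (y, z)) = of_nat k * delta x z"
    using arg_cong[OF WtW, of "\<lambda>M. M $$ (x, z)"] xz W
    by (simp add: scalar_prod_def atLeast0LessThan delta_def)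
qed (rule W)

section \<open>The seven idempotents and their orthogonality\<close>

abbreviation "J \<equiv> I.ones_block"
abbreviation "K \<equiv> V.alt_block"

text \<open>Columns of Q divided by 4v, regrouped in block form. For example, \<open>idem 2\<close>
  has diagonal blocks (1/2) J_2 \<Otimes> (G/n - J/v), and \<open>idem 5\<close>,
  \<open>idem 6\<close> combine I - G/n with plus or minus (A - (k/v) J) / r.\<close>

definition idem :: "nat \<Rightarrow> complex mat" where
  "idem i =
    (let v = of_nat m * of_nat n; s = complex_of_real (sqrt (real k)); r = complex_of_real r in
     [J 0 0 (1 / (4 * v)) 0 (1 / (4 * v)),
      K (1 / 4) (1 / (4 * s)),
      J 0 (1 / (2 * of_nat n)) (- 1 / (2 * v)) 0 0,
      K (1 / 4) (- 1 / (4 * s)),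
      J 0 0 (1 / (4 * v)) 0 (- 1 / (4 * v)),
      J (1 / 4) (- 1 / (4 * of_nat n)) 0 (1 / (4 * r)) (- of_nat k / (4 * v * r)),
      J (1 / 4) (- 1 / (4 * of_nat n)) 0 (- 1 / (4 * r)) (of_nat k / (4 * v * r))] ! i)"

lemma idem_simps:
  "idem 0 = J 0 0 (1 / (4 * (of_nat m * of_nat n))) 0 (1 / (4 * (of_nat m * of_nat n)))"
  "idem 1 = K (1 / 4) (1 / (4 * complex_of_real (sqrt (real k))))"
  "idem 2 = J 0 (1 / (2 * of_nat n)) (- 1 / (2 * (of_nat m * of_nat n))) 0 0"
  "idem 3 = K (1 / 4) (- 1 / (4 * complex_of_real (sqrt (real k))))"
  "idem 4 = J 0 0 (1 / (4 * (of_nat m * of_nat n))) 0 (- 1 / (4 * (of_nat m * of_nat n)))"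
  "idem 5 = J (1 / 4) (- 1 / (4 * of_nat n)) 0 (1 / (4 * complex_of_real r))
     (- of_nat k / (4 * (of_nat m * of_nat n) * complex_of_real r))"
  "idem 6 = J (1 / 4) (- 1 / (4 * of_nat n)) 0 (- 1 / (4 * complex_of_real r))
     (of_nat k / (4 * (of_nat m * of_nat n) * complex_of_real r))"
  by (simp_all add: idem_def Let_def)

lemma J_zero: "J 0 0 0 0 0 = 0\<^sub>m (4 * v) (4 * v)"
proof (rule mat4_eqI)
  fix p q x p' q' x' assume *: "p < (2::nat)" "q < (2::nat)" "x < v" "p' < (2::nat)" "q' < (2::nat)" "x' < v"
  then show "J 0 0 0 0 0 $$ (block_pos v p q x, block_pos v p' q' x') = 0\<^sub>m (4 * v) (4 * v) $$ (block_pos v p q x, block_pos v p' q' x')"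
    using block_pos_less[OF *(1-3)] block_pos_less[OF *(4-6)]
    by (simp add: I.ones_block_def sign_block_index group_comb_index ones_comb_index)
qed (auto simp: I.ones_block_def)

lemma K_zero: "K 0 0 = 0\<^sub>m (4 * v) (4 * v)"
proof (rule mat4_eqI)
  fix p q x p' q' x' assume *: "p < (2::nat)" "q < (2::nat)" "x < v" "p' < (2::nat)" "q' < (2::nat)" "x' < v"
  then show "K 0 0 $$ (block_pos v p q x, block_pos v p' q' x') = 0\<^sub>m (4 * v) (4 * v) $$ (block_pos v p q x, block_pos v p' q' x')"
    using W[THEN carrier_matD(1)] W[THEN carrier_matD(2)] block_pos_less[OF *(1-3)] block_pos_less[OF *(4-6)]
    by (auto simp: V.alt_block_def sign_block_index)
qed (auto simp: V.alt_block_def)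

lemma complex_nz: "of_nat m \<noteq> (0::complex)" "of_nat n \<noteq> (0::complex)" "of_nat k \<noteq> (0::complex)"
  "complex_of_real r \<noteq> 0" "complex_of_real (sqrt (real k)) \<noteq> 0"
  using mn k_pos r_pos by auto

lemma sqrt_k: "complex_of_real (sqrt (real k)) * complex_of_real (sqrt (real k)) = of_nat k"
  by (simp flip: of_real_mult)

lemmas idem_mult = I.ones_block_mult V.alt_block_mult alt_block_ones_block[OF V.weighing_axioms I.gdd_incidence_axioms]

lemma J_eqI: "\<alpha> = \<alpha>' \<Longrightarrow> \<beta> = \<beta>' \<Longrightarrow> \<gamma> = \<gamma>' \<Longrightarrow> a = a' \<Longrightarrow> b = b' \<Longrightarrow> J \<alpha> \<beta> \<gamma> a b = J \<alpha>' \<beta>' \<gamma>' a' b'"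
  by simp

lemma J_eq_zeroI: "\<alpha> = 0 \<Longrightarrow> \<beta> = 0 \<Longrightarrow> \<gamma> = 0 \<Longrightarrow> a = 0 \<Longrightarrow> b = 0 \<Longrightarrow> J \<alpha> \<beta> \<gamma> a b = 0\<^sub>m (4 * v) (4 * v)"
  by (simp add: J_zero)

lemma K_eqI: "\<alpha> = \<alpha>' \<Longrightarrow> a = a' \<Longrightarrow> K \<alpha> a = K \<alpha>' a'"
  by simp

lemma K_eq_zeroI: "\<alpha> = 0 \<Longrightarrow> a = 0 \<Longrightarrow> K \<alpha> a = 0\<^sub>m (4 * v) (4 * v)"
  by (simp add: K_zero)

lemma nonzero_params: "r \<noteq> 0" "0 < k" "0 < m" "0 < n" "k \<noteq> 0" "m \<noteq> 0" "n \<noteq> 0"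
  using r_pos k_pos mn by auto

text \<open>The product formulas reduce every case to comparing coefficients: rational identities in
  m, n, k, r inside the trivial part, and (sqrt k)^2 = k inside the alternating part. Mixed products
  vanish because the characters differ.\<close>

lemma idem_orth:
  assumes "i \<le> 6" "j \<le> 6"
  shows "idem i * idem j = (if i = j then idem i else 0\<^sub>m (4 * v) (4 * v))"
proof -
  have J: "idem i * idem j = (if i = j then idem i else 0\<^sub>m (4 * v) (4 * v))" if "i \<in> {0, 2, 4, 5, 6}" "j \<in> {0, 2, 4, 5, 6}"
    using that
    apply (elim insertE emptyE; hypsubst; simp only: refl if_True zero_neq_numeral numeral_neq_zero numeral_eq_iff num.distinct num.inject if_False)
    unfolding idem_simps idem_mult
    by (intro J_eqI J_eq_zeroI;
        (simp add: complex_nz nonzero_params power2_eq_square field_simps; fail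
        | simp add: complex_nz nonzero_params power2_eq_square; simp add: complex_nz nonzero_params field_simps))+
  have K: "idem i * idem j = (if i = j then idem i else 0\<^sub>m (4 * v) (4 * v))" if "i \<in> {1, 3}" "j \<in> {1, 3}"
    using that
    apply (elim insertE emptyE; hypsubst; simp only: refl if_True one_eq_numeral_iff numeral_eq_one_iff num.distinct num.inject if_False)
    unfolding idem_simps idem_mult
    by (intro K_eqI K_eq_zeroI; simp add: complex_nz nonzero_params sqrt_k field_simps; fail)+
  have JK: "idem i * idem j = (if i = j then idem i else 0\<^sub>m (4 * v) (4 * v))" if "i \<in> {0, 2, 4, 5, 6}" "j \<in> {1, 3}"
    using that by (elim insertE emptyE; hypsubst; simp only: idem_simps idem_mult; simp)
  have KJ: "idem i * idem j = (if i = j then idem i else 0\<^sub>m (4 * v) (4 * v))" if "i \<in> {1, 3}" "j \<in> {0, 2, 4, 5, 6}"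
    using that by (elim insertE emptyE; hypsubst; simp only: idem_simps idem_mult; simp)
  have "i \<in> {0, 2, 4, 5, 6} \<or> i \<in> {1, 3}" "j \<in> {0, 2, 4, 5, 6} \<or> j \<in> {1, 3}"
    using assms[THEN le_6_cases] by auto
  then show ?thesis using J K JK KJ by (elim disjE)
qed

section \<open>Entries and axioms of the seven relation matrices\<close>

abbreviation "S \<equiv> gdd_scheme m n W1 W2"

text \<open>The upper right block is built from M and the lower left one from its transpose; the
  block row \<open>p\<close> selects which, so one formula covers both.\<close>

definition orient :: "complex mat \<Rightarrow> nat \<Rightarrow> nat \<Rightarrow> nat \<Rightarrow> complex" where
  "orient M p x y = (if p = 0 then M $$ (x, y) else M $$ (y, x))"

lemma delta_commute: "delta x y = delta y x"
  by (simp add: delta_def)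

lemma orient_cases:
  assumes "x < v" "y < v"
  shows "orient W1 p x y = 0 \<and> orient W2 p x y = 0 \<or> orient W1 p x y = 1 \<and> orient W2 p x y = 0 \<or>
    orient W1 p x y = 0 \<and> orient W2 p x y = 1"
  using W12_cases[OF assms] W12_cases[OF assms(2,1)] unfolding orient_def by (cases "p = 0") simp_all

lemma orient_swap: "p < 2 \<Longrightarrow> p' < 2 \<Longrightarrow> p \<noteq> p' \<Longrightarrow> orient M p' y x = orient M p x y"
  by (auto simp: orient_def)

context
  fixes p q x p' q' x'
  assumes bounds: "p < (2::nat)" "q < (2::nat)" "x < v" "p' < (2::nat)" "q' < (2::nat)" "x' < v"
begin

text \<open>All later facts about the relation matrices are read off these entries. The index 1 is
  written \<open>Suc 0\<close>, the form into which the simplifier brings it.\<close>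

lemma S_index:
  "S 0 $$ (block_pos v p q x, block_pos v p' q' x') = (if p = p' \<and> q = q' then delta x x' else 0)"
  "S (Suc 0) $$ (block_pos v p q x, block_pos v p' q' x') = (if p = p' \<and> q \<noteq> q' then delta x x' else 0)"
  "S 2 $$ (block_pos v p q x, block_pos v p' q' x') = (if p = p' then same_group n x x' - delta x x' else 0)"
  "S 3 $$ (block_pos v p q x, block_pos v p' q' x') = (if p = p' then 1 - same_group n x x' else 0)"
  "S 4 $$ (block_pos v p q x, block_pos v p' q' x') =
    (if p = p' then 0 else if q = q' then orient W1 p x x' else orient W2 p x x')"
  "S 5 $$ (block_pos v p q x, block_pos v p' q' x') =
    (if p = p' then 0 else if q = q' then orient W2 p x x' else orient W1 p x x')"
  "S 6 $$ (block_pos v p q x, block_pos v p' q' x') =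
    (if p = p' then 0 else 1 - orient W1 p x x' - orient W2 p x x')"
proof -
  note W1t = transpose_carrier_mat[THEN iffD2, OF W1]
  note W2t = transpose_carrier_mat[THEN iffD2, OF W2]
  note dims = W1[THEN carrier_matD(1)] W1[THEN carrier_matD(2)] W2[THEN carrier_matD(1)] W2[THEN carrier_matD(2)]
    group_ones_carrier[THEN carrier_matD(1)] group_ones_carrier[THEN carrier_matD(2)]
    all_ones_carrier[THEN carrier_matD(1)] all_ones_carrier[THEN carrier_matD(2)]
  have kron: "M \<Otimes> X \<in> carrier_mat (2 * v) (2 * v)"
    "dim_row (M \<Otimes> X) = 2 * v" "dim_col (M \<Otimes> X) = 2 * v"
    "s < 2 \<Longrightarrow> s' < 2 \<Longrightarrow> (M \<Otimes> X) $$ (s * v + x, s' * v + x') = M $$ (s, s') * X $$ (x, x')"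
    if "M \<in> carrier_mat 2 2" "X \<in> carrier_mat v v" for M X s s'
    using kron_carrier[OF that] kron_index[OF that _ bounds(3) _ bounds(6)] by auto
  have qv: "q * v + x < 2 * v" "q' * v + x' < 2 * v"
    using less_2_times bounds by auto
  have diag: "block_diag (M \<Otimes> X) $$ (block_pos v p q x, block_pos v p' q' x') = (if p = p' then M $$ (q, q') * X $$ (x, x') else 0)"
    if "M \<in> carrier_mat 2 2" "X \<in> carrier_mat v v" for M X
    using block_diag_index[OF kron(1)[OF that] bounds] kron(4)[OF that bounds(2,5)] by simp
  have X: "group_ones m n - 1\<^sub>m v \<in> carrier_mat v v" "all_ones v - group_ones m n \<in> carrier_mat v v"
    "all_ones v - W1 - W2 \<in> carrier_mat v v" "all_ones v - transpose_mat W1 - transpose_mat W2 \<in> carrier_mat v v"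
    using W1 W2 group_ones_carrier[of m n] all_ones_carrier[of v] by (auto intro!: minus_carrier_mat)
  show "S 0 $$ (block_pos v p q x, block_pos v p' q' x') = (if p = p' \<and> q = q' then delta x x' else 0)"
    using bounds by (simp add: gdd_scheme_def Let_def diag delta_def)
  show "S (Suc 0) $$ (block_pos v p q x, block_pos v p' q' x') = (if p = p' \<and> q \<noteq> q' then delta x x' else 0)"
    using bounds by (simp add: gdd_scheme_def Let_def diag delta_def swap_mat_carrier swap_mat_index)
  show "S 2 $$ (block_pos v p q x, block_pos v p' q' x') = (if p = p' then same_group n x x' - delta x x' else 0)"
    using bounds by (simp add: gdd_scheme_def Let_def diag delta_def all_ones_carrier X all_ones_index group_ones_index dims)
  show "S 3 $$ (block_pos v p q x, block_pos v p' q' x') = (if p = p' then 1 - same_group n x x' else 0)"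
    using bounds by (simp add: gdd_scheme_def Let_def diag delta_def all_ones_carrier X all_ones_index group_ones_index dims)
  have perm: "1\<^sub>m 2 \<Otimes> X + swap_mat \<Otimes> Y \<in> carrier_mat (2 * v) (2 * v)"
    "(1\<^sub>m 2 \<Otimes> X + swap_mat \<Otimes> Y) $$ (q * v + x, q' * v + x') = (if q = q' then X $$ (x, x') else Y $$ (x, x'))"
    if XY: "X \<in> carrier_mat v v" "Y \<in> carrier_mat v v" for X Y
  proof -
    note c1 = kron(1-3)[OF one_carrier_mat XY(1)]
    note c2 = kron(1-3)[OF swap_mat_carrier XY(2)]
    show "1\<^sub>m 2 \<Otimes> X + swap_mat \<Otimes> Y \<in> carrier_mat (2 * v) (2 * v)" using c1 c2 by simp
    have "(1\<^sub>m 2 \<Otimes> X + swap_mat \<Otimes> Y) $$ (q * v + x, q' * v + x') =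
        (1\<^sub>m 2 \<Otimes> X) $$ (q * v + x, q' * v + x') + (swap_mat \<Otimes> Y) $$ (q * v + x, q' * v + x')"
      using qv c2 by (intro index_add_mat) simp_all
    also have "\<dots> = (if q = q' then X $$ (x, x') else Y $$ (x, x'))"
      unfolding kron(4)[OF one_carrier_mat XY(1) bounds(2,5)] kron(4)[OF swap_mat_carrier XY(2) bounds(2,5)]
      using bounds by (simp add: swap_mat_index)
    finally show "(1\<^sub>m 2 \<Otimes> X + swap_mat \<Otimes> Y) $$ (q * v + x, q' * v + x') = (if q = q' then X $$ (x, x') else Y $$ (x, x'))" .
  qed
  have t: "transpose_mat W1 $$ (x, x') = W1 $$ (x', x)" "transpose_mat W2 $$ (x, x') = W2 $$ (x', x)"
    using bounds(3,6) by (simp_all add: dims)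
  have S4: "S 4 = block_antidiag (1\<^sub>m 2 \<Otimes> W1 + swap_mat \<Otimes> W2)
      (1\<^sub>m 2 \<Otimes> transpose_mat W1 + swap_mat \<Otimes> transpose_mat W2)"
    and S5: "S 5 = block_antidiag (1\<^sub>m 2 \<Otimes> W2 + swap_mat \<Otimes> W1)
      (1\<^sub>m 2 \<Otimes> transpose_mat W2 + swap_mat \<Otimes> transpose_mat W1)"
    and S6: "S 6 = block_antidiag (all_ones 2 \<Otimes> (all_ones v - W1 - W2))
      (all_ones 2 \<Otimes> (all_ones v - transpose_mat W1 - transpose_mat W2))"
    by (simp_all add: gdd_scheme_def Let_def)
  show "S 4 $$ (block_pos v p q x, block_pos v p' q' x') =
    (if p = p' then 0 else if q = q' then orient W1 p x x' else orient W2 p x x')"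
    unfolding S4 block_antidiag_index[OF perm(1)[OF W1 W2] perm(1)[OF W1t W2t] bounds]
    by (cases "p = 0") (simp_all only: refl if_True if_False perm(2)[OF W1 W2] perm(2)[OF W1t W2t] orient_def t)
  show "S 5 $$ (block_pos v p q x, block_pos v p' q' x') =
    (if p = p' then 0 else if q = q' then orient W2 p x x' else orient W1 p x x')"
    unfolding S5 block_antidiag_index[OF perm(1)[OF W2 W1] perm(1)[OF W2t W1t] bounds]
    by (cases "p = 0") (simp_all only: refl if_True if_False perm(2)[OF W2 W1] perm(2)[OF W2t W1t] orient_def t)
  note compl = kron[OF all_ones_carrier X(3)] kron[OF all_ones_carrier X(4)]
  show "S 6 $$ (block_pos v p q x, block_pos v p' q' x') =
    (if p = p' then 0 else 1 - orient W1 p x x' - orient W2 p x x')"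
    unfolding S6 block_antidiag_index[OF compl(1,5) bounds]
    using bounds W1t W2t
    by (cases "p = 0")
      (simp_all only: refl if_True if_False compl(4)[OF bounds(2,5)] compl(8)[OF bounds(2,5)] orient_def all_ones_index,
       simp_all add: t dims all_ones_index)
qed

lemma J_index: "J \<alpha> \<beta> \<gamma> a b $$ (block_pos v p q x, block_pos v p' q' x') =
   (if p = p' then \<alpha> * delta x x' + \<beta> * same_group n x x' + \<gamma> else a * (orient W1 p x x' + orient W2 p x x') + b)"
  using bounds A
  by (simp add: I.ones_block_def sign_block_index group_comb_index ones_comb_index orient_def A_index)

lemma K_index: "K \<alpha> a $$ (block_pos v p q x, block_pos v p' q' x') =
   (if q = q' then 1 else - 1) * (if p = p' then \<alpha> * delta x x' else a * (orient W1 p x x' - orient W2 p x x'))"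
proof -
  have "(\<alpha> \<cdot>\<^sub>m 1\<^sub>m v) $$ (x, x') = \<alpha> * delta x x'"
    using bounds(3,6) by (simp add: delta_def)
  moreover have "(a \<cdot>\<^sub>m W) $$ (x, x') = a * (W1 $$ (x, x') - W2 $$ (x, x'))"
    "(a \<cdot>\<^sub>m transpose_mat W) $$ (x, x') = a * (W1 $$ (x', x) - W2 $$ (x', x))"
    using bounds(3,6) W_index[OF bounds(3,6)] W_index[OF bounds(6,3)]
    by (simp_all add: W[THEN carrier_matD(1)] W[THEN carrier_matD(2)])
  ultimately show ?thesis
    unfolding V.alt_block_def sign_block_index[OF bounds] by (simp add: orient_def)
qed

end

lemma S_carrier: "i \<le> 6 \<Longrightarrow> S i \<in> carrier_mat (4 * v) (4 * v)"
proof -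
  have diag: "block_diag X \<in> carrier_mat (4 * v) (4 * v)" if "X \<in> carrier_mat (2 * v) (2 * v)" for X
    using that by (auto simp: block_diag_def)
  have anti: "block_antidiag X Y \<in> carrier_mat (4 * v) (4 * v)"
    if "X \<in> carrier_mat (2 * v) (2 * v)" "Y \<in> carrier_mat (2 * v) (2 * v)" for X Y
    using that by (auto simp: block_antidiag_def)
  note W1t = transpose_carrier_mat[THEN iffD2, OF W1]
  note W2t = transpose_carrier_mat[THEN iffD2, OF W2]
  have minus: "X - Y \<in> carrier_mat v v" if "Y \<in> carrier_mat v v" for X Y :: "complex mat"
    using that by (rule minus_carrier_mat)
  assume "i \<le> 6"
  then show ?thesis
    by (drule_tac le_6_cases, elim disjE; hypsubst)
      (simp_all add: gdd_scheme_def Let_def, (intro diag anti add_carrier_mat kron_carrier minus one_carrier_mat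
        all_ones_carrier group_ones_carrier swap_mat_carrier W1 W2 W1t W2t)+)
qed

lemma idem_carrier: "i \<le> 6 \<Longrightarrow> idem i \<in> carrier_mat (4 * v) (4 * v)"
  by (drule le_6_cases, elim disjE; hypsubst) (simp_all only: idem_simps I.ones_block_def V.alt_block_def sign_block_carrier)

lemma S_01:
  assumes i: "i \<le> 6"
  shows "zero_one_mat (S i)"
  unfolding zero_one_mat_index S_carrier[OF i, THEN carrier_matD(1)] S_carrier[OF i, THEN carrier_matD(2)]
proof (intro allI impI)
  fix a b assume "a < 4 * v" "b < 4 * v"
  then obtain p q x p' q' x' where *: "p < (2::nat)" "q < (2::nat)" "x < v" "p' < (2::nat)" "q' < (2::nat)" "x' < v"
    and ab: "a = block_pos v p q x" "b = block_pos v p' q' x'" by (metis less_4_block_pos)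
  show "S i $$ (a, b) \<in> {0, 1}"
    using le_6_cases[OF i] orient_cases[OF *(3,6), of p]
    by (elim disjE) (simp_all add: S_index[OF *] ab delta_def same_group_def)
qed

text \<open>Transposing exchanges the points and, off the diagonal blocks, also the orientation; by
  \<open>orient_swap\<close> the two changes cancel.\<close>

lemma S_sym:
  assumes i: "i \<le> 6"
  shows "transpose_mat (S i) = S i"
proof (rule mat4_eqI)
  fix p q x p' q' x' assume *: "p < (2::nat)" "q < (2::nat)" "x < v" "p' < (2::nat)" "q' < (2::nat)" "x' < v"
  note ** = *(4-6) *(1-3)
  have t: "transpose_mat (S i) $$ (block_pos v p q x, block_pos v p' q' x') = S i $$ (block_pos v p' q' x', block_pos v p q x)"
    using S_carrier[OF i, THEN carrier_matD(1)] S_carrier[OF i, THEN carrier_matD(2)] block_pos_less[OF *(1-3)] block_pos_less[OF *(4-6)]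
    by simp
  show "transpose_mat (S i) $$ (block_pos v p q x, block_pos v p' q' x') = S i $$ (block_pos v p q x, block_pos v p' q' x')"
    unfolding t using le_6_cases[OF i]
    by (elim disjE; hypsubst; simp only: One_nat_def S_index[OF *] S_index[OF **]; cases "p = p'"; cases "q = q'")
      (simp_all add: orient_swap[OF *(1,4)] delta_commute[of x' x] same_group_commute[of n x' x])
qed (use S_carrier[OF i] in auto)

lemma S_zero: "S 0 = 1\<^sub>m (4 * v)"
proof (rule mat4_eqI)
  fix p q x p' q' x' assume *: "p < (2::nat)" "q < (2::nat)" "x < v" "p' < (2::nat)" "q' < (2::nat)" "x' < v"
  then show "S 0 $$ (block_pos v p q x, block_pos v p' q' x') = 1\<^sub>m (4 * v) $$ (block_pos v p q x, block_pos v p' q' x')"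
    using block_pos_less[OF *(1-3)] block_pos_less[OF *(4-6)] block_pos_eq_iff[OF *] by (simp add: S_index[OF *] delta_def)
qed (use S_carrier[of 0] in auto)

lemma S_sum: "lin_comb (4 * v) 6 (\<lambda>_. 1) S = all_ones (4 * v)"
proof (rule mat4_eqI)
  fix p q x p' q' x' assume *: "p < (2::nat)" "q < (2::nat)" "x < v" "p' < (2::nat)" "q' < (2::nat)" "x' < v"
  then show "lin_comb (4 * v) 6 (\<lambda>_. 1) S $$ (block_pos v p q x, block_pos v p' q' x') = all_ones (4 * v) $$ (block_pos v p q x, block_pos v p' q' x')"
    using block_pos_less[OF *(1-3)] block_pos_less[OF *(4-6)] by (simp add: sum_atMost_6 S_index[OF *] all_ones_index)
qed (auto simp: all_ones_carrier)

lemma S_nonzero: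
  assumes i: "i \<le> 6"
  shows "S i \<noteq> 0\<^sub>m (4 * v) (4 * v)"
proof -
  have nz: "S i \<noteq> 0\<^sub>m (4 * v) (4 * v)"
    if "S i $$ (block_pos v p q x, block_pos v p' q' x') \<noteq> 0" "p < 2" "q < 2" "x < v" "p' < 2" "q' < 2" "x' < v" for i p q x p' q' x'
    using that block_pos_less[OF that(2-4)] block_pos_less[OF that(5-7)] by auto
  have "2 * n \<le> v" using mn by simp
  then have b: "0 < v" "1 < v" "n < v" using mn by linarith+
  have sg: "same_group n 0 1 = 1" "same_group n 0 n = 0" "delta 0 1 = 0" "delta 0 0 = 1"
    using mn by (auto simp: same_group_def delta_def)
  \<comment> \<open>A row of A sums to k with 0 < k < v, so it has a nonzero entry (for
    \<open>S 4\<close> and \<open>S 5\<close>) and an entry different from 1 (for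
    \<open>S 6\<close>).\<close>
  have "\<exists>y<v. A $$ (0, y) \<noteq> 0"
  proof (rule ccontr)
    assume "\<not> ?thesis"
    then have "(\<Sum>y<v. A $$ (0, y)) = 0" by simp
    then show False using sum_A(1)[of 0] b k_pos by simp
  qed
  then obtain y where y: "y < v" "A $$ (0, y) \<noteq> 0" by blast
  have "\<exists>z<v. A $$ (0, z) \<noteq> 1"
  proof (rule ccontr)
    assume "\<not> ?thesis"
    then have "(\<Sum>y<v. A $$ (0, y)) = of_nat v" by simp
    then have "of_nat k = (of_nat v :: complex)" using sum_A(1)[of 0] b by simp
    then show False using k_less unfolding of_nat_eq_iff by simp
  qed
  then obtain z where z: "z < v" "A $$ (0, z) \<noteq> 1" by blast
  have 0: "S 0 \<noteq> 0\<^sub>m (4 * v) (4 * v)"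
    using b sg by (intro nz[of 0 0 0 0 0 0 0]) (simp_all add: S_index)
  have 1: "S 1 \<noteq> 0\<^sub>m (4 * v) (4 * v)"
    using b sg by (intro nz[of 1 0 0 0 0 1 0]) (simp_all add: S_index)
  have 2: "S 2 \<noteq> 0\<^sub>m (4 * v) (4 * v)"
    by (rule nz[of 2 0 0 0 0 0 1]; simp only: S_index b sg; simp add: b sg[unfolded One_nat_def])
  have 3: "S 3 \<noteq> 0\<^sub>m (4 * v) (4 * v)"
    using b sg by (intro nz[of 3 0 0 0 0 0 n]) (simp_all add: S_index)
  have 45: "S 4 \<noteq> 0\<^sub>m (4 * v) (4 * v) \<and> S 5 \<noteq> 0\<^sub>m (4 * v) (4 * v)"
  \<comment> \<open>Whichever of W1 and W2 is nonzero at (0, y) appears in both matrices: in one of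
    them between equal Kronecker blocks, in the other between different ones.\<close>
  proof (cases "W1 $$ (0, y) = 0")
    case True
    then have "W2 $$ (0, y) \<noteq> 0" using y b A_index[of 0 y] by simp
    then show ?thesis
      using nz[of 4 0 0 0 1 1 y] nz[of 5 0 0 0 1 0 y] b y by (simp add: S_index orient_def)
  next
    case False
    then show ?thesis
      using nz[of 4 0 0 0 1 0 y] nz[of 5 0 0 0 1 1 y] b y by (simp add: S_index orient_def)
  qed
  have 6: "S 6 \<noteq> 0\<^sub>m (4 * v) (4 * v)"
    using nz[of 6 0 0 0 1 0 z] b z A_index[of 0 z] by (simp add: S_index orient_def algebra_simps)
  show ?thesis using le_6_cases[OF i] 0 1 2 3 45 6 by auto
qed

section \<open>The eigenmatrices, their product, and the assembly\<close>

abbreviation "P \<equiv> gdd_P (real m) (real n) (real k)"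
abbreviation "Q \<equiv> gdd_Q (real m) (real n) (real k)"

definition P_rows :: "real list list" where
  "P_rows = (let m = real m; n = real n; k = real k in
      [[1,  1, 2 * (n - 1), 2 * (m - 1) * n,      k,        k,        2 * (m * n - k)],
       [1, -1, 0,           0,                    sqrt k,   - sqrt k, 0],
       [1,  1, 2 * (n - 1), - 2 * n,              0,        0,        0],
       [1, -1, 0,           0,                    - sqrt k, sqrt k,   0],
       [1,  1, 2 * (n - 1), 2 * (m - 1) * n,      - k,      - k,      2 * (k - m * n)],
       [1,  1, - 2,         0,                    r,        r,        - 2 * r],
       [1,  1, - 2,         0,                    - r,      - r,      2 * r]])"

text \<open>Compared with \<open>gdd_Q\<close>, the entries \<open>t\<close> and \<open>u\<close>
  are expressed through \<open>r\<close>. In QP the radicals then occur only next to their inverses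
  or in cancelling pairs, so the check is rational arithmetic.\<close>

definition Q_rows :: "real list list" where
  "Q_rows = (let m = real m; n = real n; k = real k; s = m * n / sqrt k; t = (m * n - k) / r; u = k / r in
      [[1, m * n,     2 * (m - 1), m * n,     1,   m * (n - 1), m * (n - 1)],
       [1, - (m * n), 2 * (m - 1), - (m * n), 1,   m * (n - 1), m * (n - 1)],
       [1, 0,         2 * (m - 1), 0,         1,   - m,         - m],
       [1, 0,         - 2,         0,         1,   0,           0],
       [1, s,         0,           - s,       - 1, t,           - t],
       [1, - s,       0,           s,         - 1, t,           - t],
       [1, 0,         0,           0,         - 1, - u,         u]])"

lemma P_index: "i \<le> 6 \<Longrightarrow> j \<le> 6 \<Longrightarrow> P $$ (i, j) = complex_of_real (P_rows ! i ! j)"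
  by (simp add: gdd_P_def P_rows_def mat_of_rows_list_def Let_def r_def)

lemma Q_params:
  "sqrt (real m * (real n - 1) * (real m * real n - real k)) / sqrt (real k) = (real m * real n - real k) / r"
  "sqrt (real k * real m * (real n - 1)) / sqrt (real m * real n - real k) = real k / r"
proof -
  \<comment> \<open>With these three roots r = Z X / Y, and both claims become cancellations: Y X /
    Z = X^2 / r and Z Y / X = Z^2 / r.\<close>
  define X Y Z where "X = sqrt (real m * real n - real k)" and "Y = sqrt (real m * (real n - 1))" and "Z = sqrt (real k)"
  have pos: "X > 0" "Y > 0" "Z > 0" using real_pos by (auto simp: X_def Y_def Z_def)
  have sq: "real m * real n - real k = X * X" "real k = Z * Z" using real_pos by (auto simp: X_def Z_def)
  have r: "r = Z * X / Y" by (simp add: r_def X_def Y_def Z_def real_sqrt_mult)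
  have "sqrt (real m * (real n - 1) * (real m * real n - real k)) = Y * X"
    by (simp add: X_def Y_def real_sqrt_mult)
  then show "sqrt (real m * (real n - 1) * (real m * real n - real k)) / sqrt (real k) = (real m * real n - real k) / r"
    unfolding sq(1) r Z_def[symmetric] using pos by (simp add: field_simps)
  have "sqrt (real k * real m * (real n - 1)) = Z * Y"
    by (simp add: Z_def Y_def real_sqrt_mult)
  then show "sqrt (real k * real m * (real n - 1)) / sqrt (real m * real n - real k) = real k / r"
    unfolding X_def[symmetric] unfolding sq(2) r using pos by (simp add: field_simps)
qed

lemma Q_index: "i \<le> 6 \<Longrightarrow> j \<le> 6 \<Longrightarrow> Q $$ (i, j) = complex_of_real (Q_rows ! i ! j)"
  unfolding gdd_Q_def Q_params by (simp add: Q_rows_def mat_of_rows_list_def Let_def)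

lemma QP_rows:
  assumes "h \<le> 6" "j \<le> 6"
  shows "(\<Sum>i\<le>6. Q_rows ! h ! i * P_rows ! i ! j) = (if h = j then 4 * (real m * real n) else 0)"
  using assms[THEN le_6_cases] nonzero_params
  by (elim disjE; hypsubst) (simp_all add: sum_atMost_6 Q_rows_def P_rows_def Let_def field_simps)

lemma QP:
  assumes "h \<le> 6" "j \<le> 6"
  shows "(\<Sum>i\<le>6. Q $$ (h, i) * P $$ (i, j)) = (if h = j then of_nat (4 * v) else 0)"
proof -
  have "(\<Sum>i\<le>6. Q $$ (h, i) * P $$ (i, j)) = complex_of_real (\<Sum>i\<le>6. Q_rows ! h ! i * P_rows ! i ! j)"
    using assms by (simp add: P_index Q_index)
  then show ?thesis unfolding QP_rows[OF assms] by simp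
qed

text \<open>In columns 1 and 3 of Q the entries of rows 4 and 5 are opposite, which assembles W = W1
  - W2; in the other columns they agree, which assembles |W| = W1 + W2.\<close>

lemma idem_eq:
  assumes j: "j \<le> 6"
  shows "idem j = (1 / of_nat (4 * v)) \<cdot>\<^sub>m lin_comb (4 * v) 6 (\<lambda>i. Q $$ (i, j)) S"
proof (rule mat4_eqI)
  fix p q x p' q' x' assume *: "p < (2::nat)" "q < (2::nat)" "x < v" "p' < (2::nat)" "q' < (2::nat)" "x' < v"
  have "((1 / of_nat (4 * v)) \<cdot>\<^sub>m lin_comb (4 * v) 6 (\<lambda>i. Q $$ (i, j)) S) $$ (block_pos v p q x, block_pos v p' q' x') =
      1 / of_nat (4 * v) * (\<Sum>i\<le>6. complex_of_real (Q_rows ! i ! j) * S i $$ (block_pos v p q x, block_pos v p' q' x'))"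
    using block_pos_less[OF *(1-3)] block_pos_less[OF *(4-6)] j lin_comb_carrier[THEN carrier_matD(1)] lin_comb_carrier[THEN carrier_matD(2)]
    by (simp add: Q_index)
  also have "\<dots> = idem j $$ (block_pos v p q x, block_pos v p' q' x')"
    using le_6_cases[OF j] nonzero_params
    apply (elim disjE; hypsubst)
    unfolding idem_simps J_index[OF *] K_index[OF *]
    by (simp_all add: sum_atMost_6 S_index[OF *] Q_rows_def Let_def field_simps)
  finally show "idem j $$ (block_pos v p q x, block_pos v p' q' x') =
    ((1 / of_nat (4 * v)) \<cdot>\<^sub>m lin_comb (4 * v) 6 (\<lambda>i. Q $$ (i, j)) S) $$ (block_pos v p q x, block_pos v p' q' x')"
    by simp
qed (use idem_carrier[OF j] in auto)

text \<open>Row 0 of Q lists the ranks of the idempotents; it serves to show that they are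
  nonzero.\<close>

lemma Q_row_0: "j \<le> 6 \<Longrightarrow> Q $$ (0, j) \<noteq> 0"
  using mn by (subst Q_index, simp, simp) (drule le_6_cases, auto simp: Q_rows_def Let_def)

lemma idem_nonzero:
  assumes j: "j \<le> 6"
  shows "idem j \<noteq> 0\<^sub>m (4 * v) (4 * v)"
proof
  assume "idem j = 0\<^sub>m (4 * v) (4 * v)"
  moreover have b: "0 < v" using mn by simp
  have p: "block_pos v 0 0 0 < 4 * v" using block_pos_less[of 0 0 0 v] b by simp
  \<comment> \<open>Among the relation matrices only \<open>S 0\<close> has a nonzero diagonal, so a
    diagonal entry isolates row 0 of Q.\<close>
  have "idem j $$ (block_pos v 0 0 0, block_pos v 0 0 0) = 1 / of_nat (4 * v) * Q $$ (0, j)"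
    unfolding idem_eq[OF j] using p b lin_comb_carrier[THEN carrier_matD(1)] lin_comb_carrier[THEN carrier_matD(2)]
    by (simp add: sum_atMost_6 S_index delta_def same_group_def)
  ultimately show False using p b Q_row_0[OF j] mn by simp
qed

lemma gdd_scheme_eigenmatrices:
  "symmetric_association_scheme (4 * v) 6 S \<and> idempotent_ordering (4 * v) 6 S idem \<and>
    first_eigenmatrix (4 * v) 6 S idem P \<and> second_eigenmatrix (4 * v) 6 S idem Q"
proof (rule scheme_from_idempotents)
  show "P \<in> carrier_mat (6 + 1) (6 + 1)" "Q \<in> carrier_mat (6 + 1) (6 + 1)"
    by (rule carrier_matI; simp add: gdd_P_def gdd_Q_def Let_def mat_of_rows_list_def)+
  show "Q $$ (i, 0) = 1" if "i \<le> 6" for i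
    using le_6_cases[OF that] by (subst Q_index[OF that]) (auto simp: Q_rows_def Let_def)
  show "orthogonal_idempotents (4 * v) 6 idem"
    by unfold_locales (simp_all add: idem_carrier idem_orth idem_nonzero)
  show "4 * v > 0" using mn by simp
qed (use S_carrier S_nonzero S_01 S_sym S_zero S_sum QP idem_eq in auto)

end

theorem theorem4p3:
  fixes W W1 W2 :: "complex mat"
    and v k m n l1 l2 :: nat
  assumes "weighing_matrix v k W"
    and "quasi_balanced W"
    and "symmetric_gdd v k m n l1 l2 (abs_mat W)"
    and "k > 0"
    and "abs_mat W * group_ones m n = (of_nat k / of_nat m) \<cdot>\<^sub>m all_ones v"
    and "group_ones m n * abs_mat W = (of_nat k / of_nat m) \<cdot>\<^sub>m all_ones v"
    and "W1 \<in> carrier_mat v v" and "W2 \<in> carrier_mat v v"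
    and "zero_one_mat W1" and "zero_one_mat W2"
    and "disjoint_mats W1 W2"
    and "W = W1 - W2"
    and "k < v"
  shows "symmetric_association_scheme (4 * v) 6 (gdd_scheme m n W1 W2) \<and>
    (\<exists>E. idempotent_ordering (4 * v) 6 (gdd_scheme m n W1 W2) E \<and>
         first_eigenmatrix (4 * v) 6 (gdd_scheme m n W1 W2) E (gdd_P (real m) (real n) (real k)) \<and>
         second_eigenmatrix (4 * v) 6 (gdd_scheme m n W1 W2) E (gdd_Q (real m) (real n) (real k)))"
proof -
  have v: "v = m * n" using assms(3) by (simp add: symmetric_gdd_def)
  interpret gdd_weighing m n k l1 l2 W W1 W2
    using assms unfolding v by unfold_locales
  show ?thesis using gdd_scheme_eigenmatrices unfolding v by blast
qed

end
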